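(* Consider the model $Y=R_{\phi_*}[X]+\eta$ described in the context. Suppose that $X$ satisfies (A1)--(A3) and that the noise satisfies (B2). Let $\beta>0$ and $L>0$. Then there exists a constant $c_{\mathrm{Lower}}>0$ independent of $M$ such that $$\liminf_{M\to\infty}\ \inf_{\widehat\phi_M}\ \sup_{\phi_*\in\mathcal C^\beta_0(L)}\mathbb E_{\phi_*}\Big[M^{\frac{2\beta}{2\beta+1}}\|\widehat\phi_M-\phi_*\|_{L^2_\rho}^2\Big]\ge c_{\mathrm{Lower}},$$ where the infimum is over all estimators $\widehat\phi_M$ based on $M$ i.i.d. samples from the model. Here $c_{\mathrm{Lower}}=c_0\,c_{\beta,N}$ with $c_0$ independent of $M$ and $N$ and $c_{\beta,N}=N^{-\frac{2\beta}{2\beta+1}}$.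
   Context: Model. Fix integers $N\ge3$, $d\ge1$. Let $X=(X_1,\dots,X_N)$ with $X_i$ random in $\mathbb R^d$, and let the noise $\eta=(\eta_1,\dots,\eta_N)\in\mathbb R^{Nd}$ be independent of $X$. For $\phi:\mathbb R^+\to\mathbb R$ let $R_\phi[X]=(R_\phi[X]_1,\dots,R_\phi[X]_N)\in\mathbb R^{Nd}$ with $$R_\phi[X]_i=\frac1{N-1}\sum_{j\ne i}\phi(\|X_i-X_j\|)\frac{X_i-X_j}{\|X_i-X_j\|}.$$ The model is $Y=R_{\phi_*}[X]+\eta$; the data $\{(X^m,Y^m)\}_{m=1}^M$ are i.i.d. samples of $(X,Y)$, and $\mathbb E_{\phi_*}$ is expectation when the true kernel is $\phi_*$. Assumptions on $X$: (A1) $X_1,\dots,X_N$ are exchangeable with finite mean; (A2) for each pair $\{X_i-X_j,X_i-X_{j'}\}$ with $j\ne j'$ and $j,j'\ne i$ there is a $\sigma$-algebra $\mathcal X_i$ given which the pair is conditionally independent; (A3) each such pair has a continuous joint probability density. Assumption on the noise: (B2) $\eta$ has a density $p_\eta$ for which there is $c_\eta>0$ with $\int_{\mathbb R^{Nd}}p_\eta(u)\log\frac{p_\eta(u)}{p_\eta(u+v)}\,du\le c_\eta\|v\|^2$ for all $v\in\mathbb R^{Nd}$. Exploration measure: $\rho(A)=\frac1{N(N-1)}\sum_{i=1}^N\sum_{j\ne i}\mathbb P(\|X_i-X_j\|\in A)$, which under (A1) is the law of $\|X_1-X_2\|$; it has a continuous density $\rho'$. It is assumed that $[0,1]\subseteq\operatorname{supp}(\rho')$,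 and $L^2_\rho=L^2_\rho([0,1])$ with $\|f\|_{L^2_\rho}^2=\int_0^1|f|^2\,d\rho$; functions on $[0,1]$ are extended by zero when inserted in $R_\phi$. Hölder class with zero boundary conditions: with $l=\lfloor\beta\rfloor$, $\mathcal C^\beta_0(L)$ is the set of $f:[0,1]\to\mathbb R$ with $|f^{(l)}(x)-f^{(l)}(y)|\le L|x-y|^{\beta-l}$ for all $x,y\in[0,1]$ and $f^{(j)}(0)=f^{(j)}(1)=0$ for $j=0,\dots,l-1$. *)

theory Defs
  imports "HOL-Probability.Probability"
begin

text \<open>
  A configuration of $N$ agents is a function on the index set $\{1,\dots,N\}$, extended by
  \<^term>\<open>undefined\<close> outside of it; these functions play the role of $\mathbb R^{Nd}$.
\<close>

definition config_space :: "nat \<Rightarrow> (nat \<Rightarrow> real ^ 'd) measure" where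
  "config_space N = Pi\<^sub>M {1..N} (\<lambda>_. borel)"

definition config_lborel :: "nat \<Rightarrow> (nat \<Rightarrow> real ^ 'd) measure" where
  "config_lborel N = Pi\<^sub>M {1..N} (\<lambda>_. lborel)"

text \<open>Kernels are functions on $[0,1]$, extended by zero. The summand is zero if $x_i = x_j$.\<close>

definition interaction :: "nat \<Rightarrow> (real \<Rightarrow> real) \<Rightarrow> (nat \<Rightarrow> real ^ 'd) \<Rightarrow> nat \<Rightarrow> real ^ 'd" where
  "interaction N \<phi> x i =
     (1 / (real N - 1)) *\<^sub>R
       (\<Sum>j\<in>{1..N} - {i}.
          (if norm (x i - x j) \<in> {0..1} then \<phi> (norm (x i - x j)) else 0) *\<^sub>R
          ((1 / norm (x i - x j)) *\<^sub>R (x i - x j)))"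

definition observation ::
  "nat \<Rightarrow> (real \<Rightarrow> real) \<Rightarrow> (nat \<Rightarrow> real ^ 'd) \<Rightarrow> (nat \<Rightarrow> real ^ 'd) \<Rightarrow> (nat \<Rightarrow> real ^ 'd)" where
  "observation N \<phi> x e = (\<lambda>i\<in>{1..N}. interaction N \<phi> x i + e i)"

definition exchangeable_finite_mean :: "'a measure \<Rightarrow> nat \<Rightarrow> ('a \<Rightarrow> nat \<Rightarrow> real ^ 'd) \<Rightarrow> bool" where
  "exchangeable_finite_mean P N X \<longleftrightarrow>
     (\<forall>\<pi>. \<pi> permutes {1..N} \<longrightarrow>
        distr P (config_space N) (\<lambda>\<omega>. \<lambda>i\<in>{1..N}. X \<omega> (\<pi> i)) = distr P (config_space N) X) \<and>
     (\<forall>i\<in>{1..N}. integrable P (\<lambda>\<omega>. X \<omega> i))"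

definition cond_indep_var ::
  "'a measure \<Rightarrow> 'a measure \<Rightarrow> ('a \<Rightarrow> 'b::topological_space) \<Rightarrow> ('a \<Rightarrow> 'c::topological_space) \<Rightarrow> bool"
where
  "cond_indep_var P F U V \<longleftrightarrow>
     (\<forall>A\<in>sets borel. \<forall>B\<in>sets borel. AE \<omega> in P.
        real_cond_exp P F (\<lambda>\<omega>. indicator A (U \<omega>) * indicator B (V \<omega>)) \<omega> =
        real_cond_exp P F (\<lambda>\<omega>. indicator A (U \<omega>)) \<omega> *
        real_cond_exp P F (\<lambda>\<omega>. indicator B (V \<omega>)) \<omega>)"

definition pairs_cond_indep :: "'a measure \<Rightarrow> nat \<Rightarrow> ('a \<Rightarrow> nat \<Rightarrow> real ^ 'd) \<Rightarrow> bool" where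
  "pairs_cond_indep P N X \<longleftrightarrow>
     (\<forall>i\<in>{1..N}. \<forall>j\<in>{1..N} - {i}. \<forall>j'\<in>{1..N} - {i, j}.
        \<exists>F. subalgebra P F \<and>
            cond_indep_var P F (\<lambda>\<omega>. X \<omega> i - X \<omega> j) (\<lambda>\<omega>. X \<omega> i - X \<omega> j'))"

definition pairs_cont_density :: "'a measure \<Rightarrow> nat \<Rightarrow> ('a \<Rightarrow> nat \<Rightarrow> real ^ 'd) \<Rightarrow> bool" where
  "pairs_cont_density P N X \<longleftrightarrow>
     (\<forall>i\<in>{1..N}. \<forall>j\<in>{1..N} - {i}. \<forall>j'\<in>{1..N} - {i, j}.
        \<exists>f :: (real ^ 'd) \<times> (real ^ 'd) \<Rightarrow> real.
          continuous_on UNIV f \<and> (\<forall>z. 0 \<le> f z) \<and>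
          distributed P lborel (\<lambda>\<omega>. (X \<omega> i - X \<omega> j, X \<omega> i - X \<omega> j')) (\<lambda>z. ennreal (f z)))"

text \<open>
  In HOL \<^term>\<open>ln (a / 0) = (0::real)\<close>, whereas the Kullback--Leibler divergence is $+\infty$ if
  $p(u) > 0 = p(u+v)$ on a set of positive measure. A finite bound on the divergence therefore is
  absolute continuity, integrability (the negative part always has a finite integral),
  and the bound on the integral.
\<close>

definition shift_KL_bound :: "nat \<Rightarrow> ((nat \<Rightarrow> real ^ 'd) \<Rightarrow> real) \<Rightarrow> real \<Rightarrow> bool" where
  "shift_KL_bound N p c \<longleftrightarrow>
     (\<forall>v\<in>space (config_space N).
        let shift = (\<lambda>u. \<lambda>i\<in>{1..N}. u i + v i) in
          (AE u in config_lborel N. 0 < p u \<longrightarrow> 0 < p (shift u)) \<and>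
          integrable (config_lborel N) (\<lambda>u. p u * ln (p u / p (shift u))) \<and>
          (\<integral>u. p u * ln (p u / p (shift u)) \<partial>config_lborel N) \<le> c * (\<Sum>i\<in>{1..N}. (norm (v i))\<^sup>2))"

definition exploration :: "'a measure \<Rightarrow> nat \<Rightarrow> ('a \<Rightarrow> nat \<Rightarrow> real ^ 'd) \<Rightarrow> real measure" where
  "exploration P N X =
     measure_of UNIV (sets borel)
       (\<lambda>A. ennreal ((1 / (real N * (real N - 1))) *
          (\<Sum>i\<in>{1..N}. \<Sum>j\<in>{1..N} - {i}. measure P {\<omega> \<in> space P. norm (X \<omega> i - X \<omega> j) \<in> A})))"

definition L2_norm_sq :: "real measure \<Rightarrow> (real \<Rightarrow> real) \<Rightarrow> ennreal" where
  "L2_norm_sq \<rho> f = (\<integral>\<^sup>+r\<in>{0..1}. ennreal ((f r)\<^sup>2) \<partial>\<rho>)"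

text \<open>
  \<^term>\<open>D j\<close> is the $j$-th derivative on $[0,1]$, one-sided at the end points. Only the values of
  \<^term>\<open>f\<close> on $[0,1]$ matter.
\<close>

definition holder_zero :: "real \<Rightarrow> real \<Rightarrow> (real \<Rightarrow> real) set" where
  "holder_zero \<beta> L = {f. let l = nat \<lfloor>\<beta>\<rfloor> in
     \<exists>D :: nat \<Rightarrow> real \<Rightarrow> real.
       (\<forall>x\<in>{0..1}. D 0 x = f x) \<and>
       (\<forall>j<l. \<forall>x\<in>{0..1}. (D j has_real_derivative D (Suc j) x) (at x within {0..1})) \<and>
       (\<forall>x\<in>{0..1}. \<forall>y\<in>{0..1}. \<bar>D l x - D l y\<bar> \<le> L * \<bar>x - y\<bar> powr (\<beta> - real l)) \<and>
       (\<forall>j<l. D j 0 = 0 \<and> D j 1 = 0)}"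

definition sample_law ::
  "'a measure \<Rightarrow> nat \<Rightarrow> ('a \<Rightarrow> nat \<Rightarrow> real ^ 'd) \<Rightarrow> ('a \<Rightarrow> nat \<Rightarrow> real ^ 'd) \<Rightarrow> (real \<Rightarrow> real)
   \<Rightarrow> ((nat \<Rightarrow> real ^ 'd) \<times> (nat \<Rightarrow> real ^ 'd)) measure" where
  "sample_law P N X \<eta> \<phi> =
     distr P (config_space N \<Otimes>\<^sub>M config_space N) (\<lambda>\<omega>. (X \<omega>, observation N \<phi> (X \<omega>) (\<eta> \<omega>)))"

definition data_law ::
  "'a measure \<Rightarrow> nat \<Rightarrow> ('a \<Rightarrow> nat \<Rightarrow> real ^ 'd) \<Rightarrow> ('a \<Rightarrow> nat \<Rightarrow> real ^ 'd) \<Rightarrow> nat \<Rightarrow> (real \<Rightarrow> real)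
   \<Rightarrow> (nat \<Rightarrow> (nat \<Rightarrow> real ^ 'd) \<times> (nat \<Rightarrow> real ^ 'd)) measure" where
  "data_law P N X \<eta> M \<phi> = Pi\<^sub>M {1..M} (\<lambda>_. sample_law P N X \<eta> \<phi>)"

text \<open>
  Joint measurability in the data and the argument makes the estimator a random function whose
  squared error is a random variable. Membership in $L^2_\rho$ is not required; the loss is
  $\infty$ otherwise.
\<close>

definition estimators ::
  "nat \<Rightarrow> nat \<Rightarrow> ((nat \<Rightarrow> (nat \<Rightarrow> real ^ 'd) \<times> (nat \<Rightarrow> real ^ 'd)) \<Rightarrow> real \<Rightarrow> real) set" where
  "estimators N M = {h. (\<lambda>(z, r). h z r) \<in> borel_measurable
     (Pi\<^sub>M {1..M} (\<lambda>_. config_space N \<Otimes>\<^sub>M config_space N) \<Otimes>\<^sub>M restrict_space borel {0..1})}"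

definition scaled_risk ::
  "'a measure \<Rightarrow> nat \<Rightarrow> ('a \<Rightarrow> nat \<Rightarrow> real ^ 'd) \<Rightarrow> ('a \<Rightarrow> nat \<Rightarrow> real ^ 'd) \<Rightarrow> real \<Rightarrow> nat
   \<Rightarrow> ((nat \<Rightarrow> (nat \<Rightarrow> real ^ 'd) \<times> (nat \<Rightarrow> real ^ 'd)) \<Rightarrow> real \<Rightarrow> real) \<Rightarrow> (real \<Rightarrow> real) \<Rightarrow> ennreal"
where
  "scaled_risk P N X \<eta> \<beta> M h \<phi> =
     (\<integral>\<^sup>+z. ennreal (real M powr (2 * \<beta> / (2 * \<beta> + 1))) *
        L2_norm_sq (exploration P N X) (\<lambda>r. h z r - \<phi> r) \<partial>data_law P N X \<eta> M \<phi>)"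

text \<open>
  The radial density \<^term>\<open>\<rho>'\<close> is a function on $[0,\infty)$; as a function on the whole line it
  would in general jump at the origin (e.g. for $d = 1$).
\<close>

definition interaction_model ::
  "'a measure \<Rightarrow> nat \<Rightarrow> ('a \<Rightarrow> nat \<Rightarrow> real ^ 'd) \<Rightarrow> ('a \<Rightarrow> nat \<Rightarrow> real ^ 'd)
   \<Rightarrow> ((nat \<Rightarrow> real ^ 'd) \<Rightarrow> real) \<Rightarrow> (real \<Rightarrow> real) \<Rightarrow> bool" where
  "interaction_model P N X \<eta> p \<rho>' \<longleftrightarrow>
     prob_space P \<and>
     prob_space.indep_var P (config_space N) X (config_space N) \<eta> \<and>
     (\<forall>u\<in>space (config_space N). 0 \<le> p u) \<and>
     distributed P (config_lborel N) \<eta> (\<lambda>u. ennreal (p u)) \<and>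
     exploration P N X = density lborel (\<lambda>r. ennreal (indicator {0..} r * \<rho>' r))"

end

theory Submission
  imports Defs "HOL-Computational_Algebra.Polynomial"
begin

text \<open>
  The lower bound combines Assouad's averaging argument with two-point tests.

  Since the density of \<open>\<rho>\<close> is continuous and its support covers the unit interval, there is an
  interval of some length \<open>w\<close> on which it lies between two positive constants (\<open>density_window\<close>).
  Divide this interval into \<open>K\<close> cells of width \<open>\<delta> = w / K\<close>, and in each cell switch a smooth bump of
  height of order \<open>\<delta> powr \<beta>\<close> on or off. All \<open>2 ^ K\<close> resulting kernels belong to the Hoelder class
  (\<open>bump_train_holder_zero\<close>). An estimator has to guess, in each cell, whether the bump is there,
  and a wrong guess costs a squared error of order \<open>\<delta> powr (2 \<beta> + 1)\<close>.

  Switching one bump translates the observation by a random vector. Each agent averages over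
  \<open>N - 1\<close> partners, so by the inequality between the mean and the root mean square the expected squared
  norm of this vector is of order \<open>N \<delta> powr (2 \<beta> + 1)\<close> (\<open>interaction_diff_mean_sq\<close>). The
  assumption on the noise converts this into a bound on the Kullback--Leibler divergence of one sample
  (\<open>likelihood_ratio_sample_law\<close>), and \<open>M\<close> independent samples multiply it by \<open>M\<close> (\<open>likelihood_ratio_PiM\<close>). If
  \<open>\<delta>\<close> is of order \<open>(M N) powr (- 1 / (2 \<beta> + 1))\<close>, the divergence stays bounded, and no test can
  recognize the bump with an error probability below some positive constant (\<open>likelihood_ratio_two_point\<close>).
  By \<open>assouad_average\<close> the losses of the \<open>K\<close> cells add up to order
  \<open>K \<delta> powr (2 \<beta> + 1)\<close>, that is \<open>\<delta> powr (2 \<beta>)\<close>, or \<open>(M N) powr (- 2 \<beta> / (2 \<beta> + 1))\<close>. The rate in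
  \<open>M\<close> cancels the normalization of the risk, and the power of \<open>N\<close> remains.
\<close>

section \<open>Likelihood ratios and two-point tests\<close>

text \<open>
  The measure with density \<open>w\<close> with respect to \<open>P\<close> lies below \<open>Q\<close>, and \<open>\<kappa>\<close> bounds the
  Kullback--Leibler divergence of \<open>P\<close> from \<open>Q\<close> from above. Domination instead of equality allows
  \<open>Q\<close> to have a part that is singular to \<open>P\<close>, which does not enter the divergence.
\<close>

definition likelihood_ratio :: "'b measure \<Rightarrow> 'b measure \<Rightarrow> ('b \<Rightarrow> real) \<Rightarrow> real \<Rightarrow> bool" where
  "likelihood_ratio P Q w \<kappa> \<longleftrightarrow>
     w \<in> borel_measurable P \<and> (\<forall>z. 0 \<le> w z) \<and> (AE z in P. 0 < w z) \<and>
     (\<forall>G\<in>borel_measurable P. (\<integral>\<^sup>+z. ennreal (w z) * G z \<partial>P) \<le> (\<integral>\<^sup>+z. G z \<partial>Q)) \<and>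
     integrable P (\<lambda>z. ln (w z)) \<and> (\<integral>z. - ln (w z) \<partial>P) \<le> \<kappa>"

text \<open>
  The overlap of two probability measures is at least the \<open>P\<close>-mean of \<open>min 1 w\<close>. Bounding it below by a
  function that is affine in \<open>ln w\<close> and \<open>w\<close> turns a bound on the divergence into a bound on the overlap:
  both \<open>ln w\<close> and \<open>w\<close> have controlled means.
\<close>

lemma min_one_ge_affine_log:
  fixes w b :: real
  assumes "0 < w" "0 \<le> b"
  shows "exp (- b) * (1 + b + ln w - w) \<le> min 1 w"
proof (cases "w \<le> 1")
  case True
  have "1 + (b + ln w) \<le> exp (b + ln w)" by (rule exp_ge_add_one_self)
  then have "1 + b + ln w - w \<le> exp b * w" using assms by (simp add: exp_add)
  then have "exp (- b) * (1 + b + ln w - w) \<le> exp (- b) * (exp b * w)"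
    by (intro mult_left_mono) auto
  also have "\<dots> = w" by (simp add: exp_minus)
  finally show ?thesis using True by simp
next
  case False
  have "ln w \<le> w - 1" using assms by (intro ln_le_minus_one)
  then have "1 + b + ln w - w \<le> exp b" using exp_ge_add_one_self[of b] by linarith
  then have "exp (- b) * (1 + b + ln w - w) \<le> exp (- b) * exp b"
    by (intro mult_left_mono) auto
  also have "\<dots> = 1" by (simp add: exp_minus)
  finally show ?thesis using False by simp
qed

lemma likelihood_ratio_integrable:
  assumes "prob_space Q" "sets Q = sets P" "likelihood_ratio P Q w \<kappa>"
  shows "integrable P w" "(\<integral>z. w z \<partial>P) \<le> 1"
proof -
  have m: "w \<in> borel_measurable P" and nn: "\<And>z. 0 \<le> w z"
    and dom: "\<And>G. G \<in> borel_measurable P \<Longrightarrow> (\<integral>\<^sup>+z. ennreal (w z) * G z \<partial>P) \<le> (\<integral>\<^sup>+z. G z \<partial>Q)"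
    using assms(3) unfolding likelihood_ratio_def by auto
  have le: "(\<integral>\<^sup>+z. ennreal (w z) \<partial>P) \<le> ennreal 1"
    using dom[of "\<lambda>_. 1"] prob_space.emeasure_space_1[OF assms(1)] by simp
  then have fin: "(\<integral>\<^sup>+z. ennreal (w z) \<partial>P) < \<infinity>"
    using le_less_trans by fastforce
  show int: "integrable P w"
    using m nn fin by (intro integrableI_nonneg) auto
  show "(\<integral>z. w z \<partial>P) \<le> 1"
    using le nn by (subst (asm) nn_integral_eq_integral[OF int]) (auto simp flip: ennreal_1)
qed

text \<open>
  Both \<open>P\<close> and \<open>Q\<close> lie above the measure with \<open>P\<close>-density \<open>min 1 w\<close>, and under that measure the
  losses \<open>F\<close> and \<open>G\<close> add up to at least \<open>a\<close> pointwise. The choice \<open>b = \<kappa> + 1\<close> in the affine bound leaves exactly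
  \<open>exp (- b)\<close>, because the mean of \<open>ln w\<close> is at least \<open>- \<kappa>\<close> and the mean of \<open>w\<close> at most 1.
\<close>

lemma likelihood_ratio_two_point:
  fixes F G :: "'b \<Rightarrow> ennreal" and a :: real
  assumes P: "prob_space P" and Q: "prob_space Q" and PQ: "sets Q = sets P"
    and w: "likelihood_ratio P Q w \<kappa>" "0 \<le> \<kappa>"
    and F[measurable]: "F \<in> borel_measurable P" and G[measurable]: "G \<in> borel_measurable P"
    and a: "0 \<le> a" "\<And>z. z \<in> space P \<Longrightarrow> ennreal a \<le> F z + G z"
  shows "ennreal (a * exp (- (\<kappa> + 1))) \<le> (\<integral>\<^sup>+z. F z \<partial>P) + (\<integral>\<^sup>+z. G z \<partial>Q)"
proof -
  interpret P: prob_space P by fact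
  note wi = likelihood_ratio_integrable[OF Q PQ w(1)]
  have m[measurable]: "w \<in> borel_measurable P" and nn: "\<And>z. 0 \<le> w z" and pos: "AE z in P. 0 < w z"
    and dom: "(\<integral>\<^sup>+z. ennreal (w z) * G z \<partial>P) \<le> (\<integral>\<^sup>+z. G z \<partial>Q)"
    and li: "integrable P (\<lambda>z. ln (w z))" and kl: "(\<integral>z. - ln (w z) \<partial>P) \<le> \<kappa>"
    using w(1) G unfolding likelihood_ratio_def by auto
  have mi: "integrable P (\<lambda>z. min 1 (w z))"
    by (rule P.integrable_const_bound[where B = 1]) (use nn in auto)
  define b where "b = \<kappa> + 1"
  have "exp (- b) \<le> exp (- b) * (1 + b + (\<integral>z. ln (w z) \<partial>P) - (\<integral>z. w z \<partial>P))"
    using kl wi(2) by (simp add: b_def)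
  also have "\<dots> = (\<integral>z. exp (- b) * (1 + b + ln (w z) - w z) \<partial>P)"
    using li wi(1) by (simp add: P.prob_space)
  also have "\<dots> \<le> (\<integral>z. min 1 (w z) \<partial>P)"
  proof (rule integral_mono_AE)
    show "AE z in P. exp (- b) * (1 + b + ln (w z) - w z) \<le> min 1 (w z)"
      using pos by eventually_elim (rule min_one_ge_affine_log, use w(2) in \<open>auto simp: b_def\<close>)
  qed (use li wi(1) mi in auto)
  finally have "ennreal (a * exp (- b)) \<le> ennreal (\<integral>z. a * min 1 (w z) \<partial>P)"
    using a(1) by (auto intro!: ennreal_leI mult_left_mono)
  also have "\<dots> = (\<integral>\<^sup>+z. ennreal (a * min 1 (w z)) \<partial>P)"
    by (rule nn_integral_eq_integral[symmetric]) (use mi nn a(1) in auto)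
  also have "\<dots> \<le> (\<integral>\<^sup>+z. F z + ennreal (w z) * G z \<partial>P)"
  proof (rule nn_integral_mono)
    fix z assume z: "z \<in> space P"
    have "ennreal (a * min 1 (w z)) = ennreal (min 1 (w z)) * ennreal a"
      using a(1) nn by (simp add: ennreal_mult' mult.commute ennreal_mult)
    also have "\<dots> \<le> ennreal (min 1 (w z)) * (F z + G z)"
      by (intro mult_left_mono a z) auto
    also have "\<dots> = ennreal (min 1 (w z)) * F z + ennreal (min 1 (w z)) * G z"
      by (rule distrib_left)
    also have "\<dots> \<le> 1 * F z + ennreal (w z) * G z"
      by (intro add_mono mult_right_mono) (auto simp: ennreal_leI simp flip: ennreal_1)
    finally show "ennreal (a * min 1 (w z)) \<le> F z + ennreal (w z) * G z" by simp
  qed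
  also have "\<dots> = (\<integral>\<^sup>+z. F z \<partial>P) + (\<integral>\<^sup>+z. ennreal (w z) * G z \<partial>P)"
    by (rule nn_integral_add) auto
  also have "\<dots> \<le> (\<integral>\<^sup>+z. F z \<partial>P) + (\<integral>\<^sup>+z. G z \<partial>Q)"
    using dom by (rule add_left_mono)
  finally show ?thesis by (simp add: b_def)
qed

text \<open>
  Domination by a density passes to finite products by integrating out one coordinate at a time.
\<close>

lemma nn_integral_PiM_dominated:
  fixes w :: "'b \<Rightarrow> ennreal"
  assumes P: "prob_space P" and Q: "prob_space Q" and PQ: "sets Q = sets P"
    and w[measurable]: "w \<in> borel_measurable P"
    and dom: "\<And>G. G \<in> borel_measurable P \<Longrightarrow> (\<integral>\<^sup>+z. w z * G z \<partial>P) \<le> (\<integral>\<^sup>+z. G z \<partial>Q)"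
    and "finite I" "G \<in> borel_measurable (Pi\<^sub>M I (\<lambda>_. P))"
  shows "(\<integral>\<^sup>+z. (\<Prod>i\<in>I. w (z i)) * G z \<partial>Pi\<^sub>M I (\<lambda>_. P)) \<le> (\<integral>\<^sup>+z. G z \<partial>Pi\<^sub>M I (\<lambda>_. Q))"
  using assms(6,7)
proof (induction I arbitrary: G)
  case empty
  then show ?case by (simp add: PiM_empty nn_integral_count_space_finite)
next
  case (insert i I)
  interpret P: prob_space P by fact
  interpret Q: prob_space Q by fact
  interpret PP: product_sigma_finite "\<lambda>_::'a. P" by standard
  interpret QQ: product_sigma_finite "\<lambda>_::'a. Q" by standard
  have [measurable_cong]: "sets Q = sets P" by fact
  have [measurable]: "G \<in> borel_measurable (Pi\<^sub>M (insert i I) (\<lambda>_. P))" by fact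
  have mG: "(\<lambda>(x, y). G (x(i := y))) \<in> borel_measurable (Pi\<^sub>M I (\<lambda>_. P) \<Otimes>\<^sub>M P)"
    by measurable
  have sPi: "sets (Pi\<^sub>M I (\<lambda>_. Q)) = sets (Pi\<^sub>M I (\<lambda>_. P))" for I :: "'a set"
    using PQ by (intro sets_PiM_cong) auto
  have mI: "(\<lambda>x. \<integral>\<^sup>+y. w y * G (x(i := y)) \<partial>P) \<in> borel_measurable (Pi\<^sub>M I (\<lambda>_. P))"
    using mG by measurable
  have "(\<integral>\<^sup>+z. (\<Prod>j\<in>insert i I. w (z j)) * G z \<partial>Pi\<^sub>M (insert i I) (\<lambda>_. P)) =
      (\<integral>\<^sup>+x. (\<integral>\<^sup>+y. (\<Prod>j\<in>insert i I. w ((x(i := y)) j)) * G (x(i := y)) \<partial>P) \<partial>Pi\<^sub>M I (\<lambda>_. P))"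
    by (rule PP.product_nn_integral_insert) (use insert.hyps in measurable)
  also have "\<dots> = (\<integral>\<^sup>+x. (\<Prod>j\<in>I. w (x j)) * (\<integral>\<^sup>+y. w y * G (x(i := y)) \<partial>P) \<partial>Pi\<^sub>M I (\<lambda>_. P))"
  proof (rule nn_integral_cong)
    fix x assume x: "x \<in> space (Pi\<^sub>M I (\<lambda>_. P))"
    have pr: "(\<Prod>j\<in>insert i I. w ((x(i := y)) j)) = (\<Prod>j\<in>I. w (x j)) * w y" for y
    proof -
      have "(\<Prod>j\<in>I. w ((x(i := y)) j)) = (\<Prod>j\<in>I. w (x j))"
        using insert.hyps by (intro prod.cong) auto
      then show ?thesis using insert.hyps by (simp add: mult.commute)
    qed
    have [measurable]: "(\<lambda>y. G (x(i := y))) \<in> borel_measurable P"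
      using measurable_Pair2[OF mG x] by simp
    show "(\<integral>\<^sup>+y. (\<Prod>j\<in>insert i I. w ((x(i := y)) j)) * G (x(i := y)) \<partial>P) =
        (\<Prod>j\<in>I. w (x j)) * (\<integral>\<^sup>+y. w y * G (x(i := y)) \<partial>P)"
      by (simp only: pr mult.assoc) (rule nn_integral_cmult, measurable)
  qed
  also have "\<dots> \<le> (\<integral>\<^sup>+x. (\<integral>\<^sup>+y. w y * G (x(i := y)) \<partial>P) \<partial>Pi\<^sub>M I (\<lambda>_. Q))"
    by (rule insert.IH[OF mI])
  also have "\<dots> \<le> (\<integral>\<^sup>+x. (\<integral>\<^sup>+y. G (x(i := y)) \<partial>Q) \<partial>Pi\<^sub>M I (\<lambda>_. Q))"
  proof (rule nn_integral_mono)
    fix x assume "x \<in> space (Pi\<^sub>M I (\<lambda>_. Q))"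
    then have x: "x \<in> space (Pi\<^sub>M I (\<lambda>_. P))" using sets_eq_imp_space_eq[OF sPi] by auto
    have "(\<lambda>y. G (x(i := y))) \<in> borel_measurable P"
      using measurable_Pair2[OF mG x] by simp
    then show "(\<integral>\<^sup>+y. w y * G (x(i := y)) \<partial>P) \<le> (\<integral>\<^sup>+y. G (x(i := y)) \<partial>Q)" by (rule dom)
  qed
  also have "\<dots> = (\<integral>\<^sup>+z. G z \<partial>Pi\<^sub>M (insert i I) (\<lambda>_. Q))"
    by (rule QQ.product_nn_integral_insert[symmetric])
      (use insert in \<open>auto cong: measurable_cong_sets simp: measurable_cong_sets[OF sPi refl]\<close>)
  finally show ?case .
qed

text \<open>
  The divergence of a product is the sum of the divergences, since the logarithm of the product
  of the ratios is a sum whose terms depend on one coordinate each.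
\<close>

lemma likelihood_ratio_PiM:
  assumes P: "prob_space P" and Q: "prob_space Q" and PQ: "sets Q = sets P"
    and w: "likelihood_ratio P Q w \<kappa>" and I: "finite I"
  shows "likelihood_ratio (Pi\<^sub>M I (\<lambda>_. P)) (Pi\<^sub>M I (\<lambda>_. Q)) (\<lambda>z. \<Prod>i\<in>I. w (z i)) (real (card I) * \<kappa>)"
proof -
  interpret PP: product_prob_space "\<lambda>_. P" I
    using P by (intro product_prob_spaceI) auto
  have m[measurable]: "w \<in> borel_measurable P" and nn: "\<And>z. 0 \<le> w z" and pos: "AE z in P. 0 < w z"
    and dom: "\<And>G. G \<in> borel_measurable P \<Longrightarrow> (\<integral>\<^sup>+z. ennreal (w z) * G z \<partial>P) \<le> (\<integral>\<^sup>+z. G z \<partial>Q)"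
    and li: "integrable P (\<lambda>z. ln (w z))" and kl: "(\<integral>z. - ln (w z) \<partial>P) \<le> \<kappa>"
    using w unfolding likelihood_ratio_def by auto
  have comp: "distr (Pi\<^sub>M I (\<lambda>_. P)) P (\<lambda>z. z i) = P" if "i \<in> I" for i
    using PP.PiM_component[OF that] by simp
  have posI: "AE z in Pi\<^sub>M I (\<lambda>_. P). \<forall>i\<in>I. 0 < w (z i)"
    using I pos by (intro AE_finite_allI AE_PiM_component[where M = "\<lambda>_. P"]) (auto simp: P)
  have lii: "integrable (Pi\<^sub>M I (\<lambda>_. P)) (\<lambda>z. ln (w (z i)))" if "i \<in> I" for i
  proof -
    have "integrable (distr (Pi\<^sub>M I (\<lambda>_. P)) P (\<lambda>z. z i)) (\<lambda>z. ln (w z))" using comp[OF that] li by simp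
    then show ?thesis using that by (subst (asm) integrable_distr_eq) auto
  qed
  have inti: "(\<integral>z. ln (w (z i)) \<partial>Pi\<^sub>M I (\<lambda>_. P)) = (\<integral>z. ln (w z) \<partial>P)" if "i \<in> I" for i
  proof -
    have "(\<integral>z. ln (w z) \<partial>P) = (\<integral>z. ln (w z) \<partial>distr (Pi\<^sub>M I (\<lambda>_. P)) P (\<lambda>z. z i))"
      using comp[OF that] by simp
    also have "\<dots> = (\<integral>z. ln (w (z i)) \<partial>Pi\<^sub>M I (\<lambda>_. P))"
      using that by (subst integral_distr) auto
    finally show ?thesis by simp
  qed
  have lnprod: "AE z in Pi\<^sub>M I (\<lambda>_. P). (\<Sum>i\<in>I. ln (w (z i))) = ln (\<Prod>i\<in>I. w (z i))"
    using posI by eventually_elim (subst ln_prod, auto simp: I)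
  have mln[measurable]: "(\<lambda>z. \<Prod>i\<in>I. w (z i)) \<in> borel_measurable (Pi\<^sub>M I (\<lambda>_. P))"
    by measurable
  have "integrable (Pi\<^sub>M I (\<lambda>_. P)) (\<lambda>z. \<Sum>i\<in>I. ln (w (z i)))" using lii by auto
  then have int: "integrable (Pi\<^sub>M I (\<lambda>_. P)) (\<lambda>z. ln (\<Prod>i\<in>I. w (z i)))"
    by (rule integrable_cong_AE_imp) (use lnprod in auto)
  have "(\<integral>z. ln (\<Prod>i\<in>I. w (z i)) \<partial>Pi\<^sub>M I (\<lambda>_. P)) =
      (\<integral>z. (\<Sum>i\<in>I. ln (w (z i))) \<partial>Pi\<^sub>M I (\<lambda>_. P))"
    by (rule integral_cong_AE) (use lnprod in auto)
  also have "\<dots> = (\<Sum>i\<in>I. (\<integral>z. ln (w (z i)) \<partial>Pi\<^sub>M I (\<lambda>_. P)))"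
    by (rule Bochner_Integration.integral_sum) (use lii in auto)
  also have "\<dots> = real (card I) * (\<integral>z. ln (w z) \<partial>P)" using inti by simp
  finally have eq: "(\<integral>z. ln (\<Prod>i\<in>I. w (z i)) \<partial>Pi\<^sub>M I (\<lambda>_. P)) = real (card I) * (\<integral>z. ln (w z) \<partial>P)" .
  have "(\<integral>z. - ln (\<Prod>i\<in>I. w (z i)) \<partial>Pi\<^sub>M I (\<lambda>_. P)) = real (card I) * (\<integral>z. - ln (w z) \<partial>P)"
    using eq by simp
  also have "\<dots> \<le> real (card I) * \<kappa>" using kl by (intro mult_left_mono) auto
  finally have kl': "(\<integral>z. - ln (\<Prod>i\<in>I. w (z i)) \<partial>Pi\<^sub>M I (\<lambda>_. P)) \<le> real (card I) * \<kappa>" .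
  have "(\<integral>\<^sup>+z. ennreal (\<Prod>i\<in>I. w (z i)) * G z \<partial>Pi\<^sub>M I (\<lambda>_. P)) \<le> (\<integral>\<^sup>+z. G z \<partial>Pi\<^sub>M I (\<lambda>_. Q))"
    if "G \<in> borel_measurable (Pi\<^sub>M I (\<lambda>_. P))" for G
    using nn_integral_PiM_dominated[OF P Q PQ, of "\<lambda>z. ennreal (w z)", OF _ dom I that] nn
    by (simp add: prod_ennreal)
  moreover have "AE z in Pi\<^sub>M I (\<lambda>_. P). 0 < (\<Prod>i\<in>I. w (z i))"
    using posI by eventually_elim (auto intro: prod_pos)
  ultimately show ?thesis
    unfolding likelihood_ratio_def using int kl' mln nn by (auto intro: prod_nonneg)
qed

section \<open>Configurations and the exploration measure\<close>

text \<open>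
  Configurations are extensional functions, so the vector space operations on them have to
  be restricted to the index set.
\<close>

definition config_plus :: "nat \<Rightarrow> (nat \<Rightarrow> real ^ 'd) \<Rightarrow> (nat \<Rightarrow> real ^ 'd) \<Rightarrow> nat \<Rightarrow> real ^ 'd" where
  "config_plus N u v = (\<lambda>i\<in>{1..N}. u i + v i)"

definition config_minus :: "nat \<Rightarrow> (nat \<Rightarrow> real ^ 'd) \<Rightarrow> (nat \<Rightarrow> real ^ 'd) \<Rightarrow> nat \<Rightarrow> real ^ 'd" where
  "config_minus N u v = (\<lambda>i\<in>{1..N}. u i - v i)"

lemma space_config_space: "space (config_space N) = extensional {1..N}"
  by (simp add: config_space_def space_PiM PiE_def)

lemma config_in_space [simp]:
  "config_plus N u v \<in> space (config_space N)" "config_minus N u v \<in> space (config_space N)"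
  by (simp_all add: space_config_space config_plus_def config_minus_def)

text \<open>
  With \<open>v\<close> and \<open>v'\<close> the interaction fields of two kernels at the same positions, an observation
  \<open>v + u\<close> made under the first kernel is read under the second one as the noise
  \<open>u + (v - v')\<close>.
\<close>

lemma config_minus_plus:
  assumes "u \<in> space (config_space N)"
  shows "config_minus N (config_plus N v u) v = u"
    "config_minus N (config_plus N v u) v' = config_plus N u (config_minus N v v')"
    "config_plus N v u = config_plus N v' (config_plus N u (config_minus N v v'))"
  using assms
  by (auto simp: config_minus_def config_plus_def space_config_space fun_eq_iff extensional_def)

lemma sets_config_lborel [measurable_cong]:
  "sets (config_lborel N :: (nat \<Rightarrow> real ^ 'd) measure) = sets (config_space N)"
  unfolding config_lborel_def config_space_def by (intro sets_PiM_cong) auto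

lemma space_config_lborel:
  "space (config_lborel N :: (nat \<Rightarrow> real ^ 'd) measure) = space (config_space N)"
  by (rule sets_eq_imp_space_eq[OF sets_config_lborel])

lemma measurable_config_component:
  "i \<in> {1..N} \<Longrightarrow> (\<lambda>u. u i) \<in> borel_measurable (config_space N :: (nat \<Rightarrow> real ^ 'd) measure)"
  unfolding config_space_def by (rule measurable_component_singleton)

lemma measurable_config_plus [measurable (raw)]:
  fixes f g :: "'b \<Rightarrow> nat \<Rightarrow> real ^ 'd"
  assumes "f \<in> measurable A (config_space N)" "g \<in> measurable A (config_space N)"
  shows "(\<lambda>x. config_plus N (f x) (g x)) \<in> measurable A (config_space N)"
    "(\<lambda>x. config_minus N (f x) (g x)) \<in> measurable A (config_space N)"
proof -
  have [measurable]: "(\<lambda>x. f x i) \<in> borel_measurable A" "(\<lambda>x. g x i) \<in> borel_measurable A"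
    if "i \<in> {1..N}" for i
    using measurable_compose[OF _ measurable_config_component[OF that]] assms by auto
  show "(\<lambda>x. config_plus N (f x) (g x)) \<in> measurable A (config_space N)"
    unfolding config_space_def config_plus_def by (rule measurable_restrict) measurable
  show "(\<lambda>x. config_minus N (f x) (g x)) \<in> measurable A (config_space N)"
    unfolding config_space_def config_minus_def by (rule measurable_restrict) measurable
qed

lemma distr_config_lborel_plus:
  fixes v :: "nat \<Rightarrow> real ^ 'd"
  assumes [measurable]: "v \<in> space (config_space N)"
  shows "distr (config_lborel N) (config_lborel N) (\<lambda>u. config_plus N u v) = config_lborel N"
proof -
  interpret product_sigma_finite "\<lambda>_::nat. lborel :: (real ^ 'd) measure" by standard
  have m[measurable]: "(\<lambda>u. config_plus N u v) \<in> measurable (config_lborel N) (config_lborel N)"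
    by measurable
  have "distr (config_lborel N) (config_lborel N) (\<lambda>u. config_plus N u v) = Pi\<^sub>M {1..N} (\<lambda>_. lborel)"
  proof (rule PiM_eqI)
    fix A :: "nat \<Rightarrow> (real ^ 'd) set" assume A: "\<And>i. i \<in> {1..N} \<Longrightarrow> A i \<in> sets lborel"
    have mA: "Pi\<^sub>E {1..N} A \<in> sets (config_lborel N)"
      unfolding config_lborel_def using A by (intro sets_PiM_I_finite) auto
    have vA: "(\<lambda>y. v i + y) -` A i \<in> sets lborel" if "i \<in> {1..N}" for i
      using measurable_sets[of "\<lambda>y. v i + y" borel borel "A i"] A[OF that] by simp
    have "emeasure (distr (config_lborel N) (config_lborel N) (\<lambda>u. config_plus N u v)) (Pi\<^sub>E {1..N} A)
        = emeasure (config_lborel N) ((\<lambda>u. config_plus N u v) -` Pi\<^sub>E {1..N} A \<inter> space (config_lborel N))"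
      by (rule emeasure_distr[OF m mA])
    also have "(\<lambda>u. config_plus N u v) -` Pi\<^sub>E {1..N} A \<inter> space (config_lborel N)
        = Pi\<^sub>E {1..N} (\<lambda>i. (\<lambda>y. v i + y) -` A i)"
      by (auto simp: space_config_lborel space_config_space config_plus_def PiE_iff extensional_def add.commute)
    also have "emeasure (config_lborel N) \<dots> = (\<Prod>i\<in>{1..N}. emeasure lborel ((\<lambda>y. v i + y) -` A i))"
      unfolding config_lborel_def using vA by (intro emeasure_PiM) auto
    also have "\<dots> = (\<Prod>i\<in>{1..N}. emeasure lborel (A i))"
    proof (rule prod.cong)
      fix i assume i: "i \<in> {1..N}"
      have "emeasure lborel (A i) = emeasure (distr lborel borel ((+) (v i))) (A i)"
        by (simp add: lborel_distr_plus)
      also have "\<dots> = emeasure lborel ((\<lambda>y. v i + y) -` A i)"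
        using A[OF i] by (subst emeasure_distr) auto
      finally show "emeasure lborel ((\<lambda>y. v i + y) -` A i) = emeasure lborel (A i)" by simp
    qed simp
    finally show "emeasure (distr (config_lborel N) (config_lborel N) (\<lambda>u. config_plus N u v)) (Pi\<^sub>E {1..N} A)
        = (\<Prod>i\<in>{1..N}. emeasure lborel (A i))" .
  qed (simp_all add: config_lborel_def)
  then show ?thesis by (simp add: config_lborel_def)
qed

lemma nn_integral_config_lborel_plus:
  fixes v :: "nat \<Rightarrow> real ^ 'd"
  assumes [measurable]: "f \<in> borel_measurable (config_space N)" and v[measurable]: "v \<in> space (config_space N)"
  shows "(\<integral>\<^sup>+u. f (config_plus N u v) \<partial>config_lborel N) = (\<integral>\<^sup>+u. f u \<partial>config_lborel N)"
proof -
  have "(\<integral>\<^sup>+u. f u \<partial>config_lborel N) =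
      (\<integral>\<^sup>+u. f u \<partial>distr (config_lborel N) (config_lborel N) (\<lambda>u. config_plus N u v))"
    by (simp only: distr_config_lborel_plus[OF v])
  also have "\<dots> = (\<integral>\<^sup>+u. f (config_plus N u v) \<partial>config_lborel N)"
    by (rule nn_integral_distr) measurable
  finally show ?thesis by simp
qed

lemma interaction_measurable:
  fixes f :: "'b \<Rightarrow> nat \<Rightarrow> real ^ 'd"
  assumes [measurable]: "\<phi> \<in> borel_measurable borel" "f \<in> measurable A (config_space N)"
    and i: "i \<in> {1..N}"
  shows "(\<lambda>z. interaction N \<phi> (f z) i) \<in> borel_measurable A"
proof -
  have [measurable]: "(\<lambda>z. f z k) \<in> borel_measurable A" if "k \<in> {1..N}" for k
    using measurable_compose[OF assms(2) measurable_config_component[OF that]] .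
  show ?thesis unfolding interaction_def using i by measurable
qed

text \<open>
  The noiseless observation as an element of the configuration space.
\<close>

definition drift :: "nat \<Rightarrow> (real \<Rightarrow> real) \<Rightarrow> (nat \<Rightarrow> real ^ 'd) \<Rightarrow> nat \<Rightarrow> real ^ 'd" where
  "drift N \<phi> x = (\<lambda>i\<in>{1..N}. interaction N \<phi> x i)"

lemma drift_measurable [measurable (raw)]:
  fixes f :: "'b \<Rightarrow> nat \<Rightarrow> real ^ 'd"
  assumes "\<phi> \<in> borel_measurable borel" "f \<in> measurable A (config_space N)"
  shows "(\<lambda>z. drift N \<phi> (f z)) \<in> measurable A (config_space N)"
  unfolding drift_def config_space_def
  by (rule measurable_restrict) (rule interaction_measurable[OF assms])

lemma observation_eq: "observation N \<phi> x u = config_plus N (drift N \<phi> x) u"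
  by (auto simp: observation_def config_plus_def drift_def)

text \<open>
  The interaction at agent \<open>i\<close> is an average over \<open>N - 1\<close> partners of vectors of norm at most
  \<open>B\<close>, so the square of its norm is at most the average of the squares. This step keeps the total
  over all agents of order \<open>N\<close>.
\<close>

lemma interaction_diff_norm_sq:
  fixes x :: "nat \<Rightarrow> real ^ 'd"
  assumes N: "3 \<le> N" and i: "i \<in> {1..N}"
    and B: "\<And>r. \<bar>\<phi> r - \<phi>' r\<bar> \<le> B * indicator \<Delta> r" "0 \<le> B"
  shows "(norm (interaction N \<phi> x i - interaction N \<phi>' x i))\<^sup>2
    \<le> B\<^sup>2 / (real N - 1) * (\<Sum>j\<in>{1..N} - {i}. indicator \<Delta> (norm (x i - x j)))"
proof -
  define J where "J = {1..N} - {i}"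
  have J: "real (card J) = real N - 1" using i N by (simp add: J_def of_nat_diff)
  have N1: "0 < real N - 1" using N by simp
  define e where "e j = (1 / norm (x i - x j)) *\<^sub>R (x i - x j)" for j
  define \<psi> where "\<psi> \<phi> r = (if r \<in> {0..1} then \<phi> r else 0)" for \<phi> :: "real \<Rightarrow> real" and r :: real
  have e: "norm (e j) \<le> 1" for j by (cases "x i = x j") (auto simp: e_def)
  have summand: "norm ((\<psi> \<phi> (norm (x i - x j)) - \<psi> \<phi>' (norm (x i - x j))) *\<^sub>R e j)
      \<le> B * indicator \<Delta> (norm (x i - x j))" for j
  proof -
    have "\<bar>\<psi> \<phi> (norm (x i - x j)) - \<psi> \<phi>' (norm (x i - x j))\<bar> \<le> B * indicator \<Delta> (norm (x i - x j))"
      using B(1)[of "norm (x i - x j)"] B(2) by (auto simp: \<psi>_def indicator_def split: if_splits)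
    from mult_mono[OF this e[of j]] show ?thesis using B(2) by simp
  qed
  have "interaction N \<phi> x i = (1 / (real N - 1)) *\<^sub>R (\<Sum>j\<in>J. \<psi> \<phi> (norm (x i - x j)) *\<^sub>R e j)" for \<phi>
    by (simp add: interaction_def J_def e_def \<psi>_def)
  then have "interaction N \<phi> x i - interaction N \<phi>' x i =
      (1 / (real N - 1)) *\<^sub>R (\<Sum>j\<in>J. (\<psi> \<phi> (norm (x i - x j)) - \<psi> \<phi>' (norm (x i - x j))) *\<^sub>R e j)"
    by (simp add: scaleR_diff_left sum_subtractf scaleR_diff_right)
  then have "norm (interaction N \<phi> x i - interaction N \<phi>' x i) =
      (1 / (real N - 1)) * norm (\<Sum>j\<in>J. (\<psi> \<phi> (norm (x i - x j)) - \<psi> \<phi>' (norm (x i - x j))) *\<^sub>R e j)"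
    using N1 by simp
  also have "\<dots> \<le> (1 / (real N - 1)) * (\<Sum>j\<in>J. B * indicator \<Delta> (norm (x i - x j)))"
    using N1 by (intro mult_left_mono sum_norm_le summand) simp
  finally have "norm (interaction N \<phi> x i - interaction N \<phi>' x i) \<le>
      (1 / (real N - 1)) * (\<Sum>j\<in>J. B * indicator \<Delta> (norm (x i - x j)))" .
  then have "(norm (interaction N \<phi> x i - interaction N \<phi>' x i))\<^sup>2 \<le>
      ((1 / (real N - 1)) * (\<Sum>j\<in>J. B * indicator \<Delta> (norm (x i - x j))))\<^sup>2"
    by (intro power_mono) auto
  also have "\<dots> = (1 / (real N - 1))\<^sup>2 * (\<Sum>j\<in>J. B * indicator \<Delta> (norm (x i - x j)))\<^sup>2"
    by (rule power_mult_distrib)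
  also have "\<dots> \<le> (1 / (real N - 1))\<^sup>2 * ((\<Sum>j\<in>J. (B * indicator \<Delta> (norm (x i - x j)))\<^sup>2) * card J)"
    by (intro mult_left_mono sum_squared_le_sum_of_squares) auto
  also have "(\<Sum>j\<in>J. (B * indicator \<Delta> (norm (x i - x j)))\<^sup>2) = B\<^sup>2 * (\<Sum>j\<in>J. indicator \<Delta> (norm (x i - x j)))"
    unfolding sum_distrib_left by (intro sum.cong) (auto simp: indicator_def)
  also have "(1 / (real N - 1))\<^sup>2 * (B\<^sup>2 * (\<Sum>j\<in>J. indicator \<Delta> (norm (x i - x j))) * card J) =
      B\<^sup>2 / (real N - 1) * (\<Sum>j\<in>J. indicator \<Delta> (norm (x i - x j)))"
  proof -
    have "(1 / n)\<^sup>2 * (b * s * n) = b / n * s" if "0 < n" for n b s :: real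
      using that by (simp add: power2_eq_square)
    from this[OF N1] show ?thesis by (simp add: J)
  qed
  finally show ?thesis by (simp add: J_def)
qed

text \<open>
  The set function in the definition of the exploration measure is countably additive: it is a
  weighted sum of the laws of the pairwise distances.
\<close>

lemma emeasure_exploration:
  fixes X :: "'a \<Rightarrow> nat \<Rightarrow> real ^ 'd"
  assumes P: "prob_space P" and X: "X \<in> measurable P (config_space N)"
    and N: "3 \<le> N" and A: "A \<in> sets borel"
  shows "emeasure (exploration P N X) A =
    ennreal ((1 / (real N * (real N - 1))) *
      (\<Sum>i\<in>{1..N}. \<Sum>j\<in>{1..N} - {i}. measure P {\<omega> \<in> space P. norm (X \<omega> i - X \<omega> j) \<in> A}))"
proof -
  interpret prob_space P by fact
  define c where "c = 1 / (real N * (real N - 1))"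
  define q where "q i j = distr P borel (\<lambda>\<omega>. norm (X \<omega> i - X \<omega> j))" for i j
  define \<mu> where "\<mu> = (\<lambda>A. ennreal (c * (\<Sum>i\<in>{1..N}. \<Sum>j\<in>{1..N} - {i}.
      measure P {\<omega> \<in> space P. norm (X \<omega> i - X \<omega> j) \<in> A})))"
  have c: "0 \<le> c" using N by (simp add: c_def)
  have comp: "(\<lambda>\<omega>. X \<omega> k) \<in> borel_measurable P" if "k \<in> {1..N}" for k
    using measurable_compose[OF X measurable_config_component[OF that]] .
  have q: "emeasure (q i j) A = ennreal (measure P {\<omega> \<in> space P. norm (X \<omega> i - X \<omega> j) \<in> A})"
    if "i \<in> {1..N}" "j \<in> {1..N}" "A \<in> sets borel" for i j A
  proof -
    have "(\<lambda>\<omega>. norm (X \<omega> i - X \<omega> j)) \<in> borel_measurable P"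
      using comp[OF that(1)] comp[OF that(2)] by measurable
    then show ?thesis using that(3)
      by (simp add: q_def emeasure_distr vimage_def Int_def conj_commute emeasure_eq_measure)
  qed
  have \<mu>: "\<mu> A = (\<Sum>i\<in>{1..N}. \<Sum>j\<in>{1..N} - {i}. ennreal c * emeasure (q i j) A)"
    if "A \<in> sets borel" for A
  proof -
    have "(\<Sum>i\<in>{1..N}. \<Sum>j\<in>{1..N} - {i}. ennreal c * emeasure (q i j) A) =
      (\<Sum>i\<in>{1..N}. \<Sum>j\<in>{1..N} - {i}. ennreal (c * measure P {\<omega> \<in> space P. norm (X \<omega> i - X \<omega> j) \<in> A}))"
      using q that c by (intro sum.cong) (auto simp: ennreal_mult')
    also have "\<dots> = \<mu> A"
      using c by (simp add: \<mu>_def sum_ennreal sum_nonneg sum_distrib_left)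
    finally show ?thesis by simp
  qed
  have sq: "sets (q i j) = sets borel" for i j by (simp add: q_def)
  have ca: "countably_additive (sets borel) \<mu>"
  proof (rule countably_additiveI)
    fix B :: "nat \<Rightarrow> real set" assume B: "range B \<subseteq> sets borel" "disjoint_family B" "\<Union> (range B) \<in> sets borel"
    have "(\<Sum>n. \<mu> (B n)) = (\<Sum>n. \<Sum>i\<in>{1..N}. \<Sum>j\<in>{1..N} - {i}. ennreal c * emeasure (q i j) (B n))"
      using B(1) by (intro suminf_cong \<mu>) auto
    also have "\<dots> = (\<Sum>i\<in>{1..N}. \<Sum>j\<in>{1..N} - {i}. ennreal c * (\<Sum>n. emeasure (q i j) (B n)))"
      by (simp add: suminf_sum)
    also have "\<dots> = (\<Sum>i\<in>{1..N}. \<Sum>j\<in>{1..N} - {i}. ennreal c * emeasure (q i j) (\<Union> (range B)))"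
      using B by (simp add: suminf_emeasure sq)
    also have "\<dots> = \<mu> (\<Union> (range B))" using \<mu>[OF B(3)] by simp
    finally show "(\<Sum>n. \<mu> (B n)) = \<mu> (\<Union> (range B))" .
  qed
  have "emeasure (exploration P N X) A = \<mu> A"
  proof (rule emeasure_measure_of[where \<mu> = \<mu> and A = "sets borel" and \<Omega> = UNIV])
    show "exploration P N X = measure_of UNIV (sets borel) \<mu>"
      by (simp add: exploration_def \<mu>_def c_def)
    have "sets (exploration P N X) = sets borel"
      by (simp add: exploration_def sets.sigma_sets_eq[of borel, simplified])
    then show "positive (sets (exploration P N X)) \<mu>" "countably_additive (sets (exploration P N X)) \<mu>"
      "A \<in> sets (exploration P N X)"
      using ca A by (auto simp: positive_def \<mu>_def)
  qed simp
  then show ?thesis by (simp add: \<mu>_def c_def)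
qed

text \<open>
  Summed over \<open>i\<close>, the averages over the partners reproduce the exploration measure, which is
  where the factor \<open>N\<close> in the effective sample size \<open>M N\<close> comes from.
\<close>

lemma interaction_diff_mean_sq:
  fixes X :: "'a \<Rightarrow> nat \<Rightarrow> real ^ 'd"
  assumes P: "prob_space P" and X: "X \<in> measurable P (config_space N)"
    and N: "3 \<le> N" and \<Delta>: "\<Delta> \<in> sets borel"
    and B: "\<And>r. \<bar>\<phi> r - \<phi>' r\<bar> \<le> B * indicator \<Delta> r" "0 \<le> B"
    and \<phi>: "\<phi> \<in> borel_measurable borel" "\<phi>' \<in> borel_measurable borel"
  shows "integrable P (\<lambda>\<omega>. \<Sum>i\<in>{1..N}. (norm (interaction N \<phi> (X \<omega>) i - interaction N \<phi>' (X \<omega>) i))\<^sup>2)"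
    and "(\<integral>\<omega>. (\<Sum>i\<in>{1..N}. (norm (interaction N \<phi> (X \<omega>) i - interaction N \<phi>' (X \<omega>) i))\<^sup>2) \<partial>P)
      \<le> real N * B\<^sup>2 * measure (exploration P N X) \<Delta>"
proof -
  interpret prob_space P by fact
  define S where "S \<omega> = (\<Sum>i\<in>{1..N}. \<Sum>j\<in>{1..N} - {i}. indicator \<Delta> (norm (X \<omega> i - X \<omega> j)) :: real)" for \<omega>
  define V where "V \<omega> = (\<Sum>i\<in>{1..N}. (norm (interaction N \<phi> (X \<omega>) i - interaction N \<phi>' (X \<omega>) i))\<^sup>2)" for \<omega>
  have comp: "(\<lambda>\<omega>. X \<omega> k) \<in> borel_measurable P" if "k \<in> {1..N}" for k
    using measurable_compose[OF X measurable_config_component[OF that]] .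
  have ev: "{\<omega> \<in> space P. norm (X \<omega> i - X \<omega> j) \<in> \<Delta>} \<in> sets P" if "i \<in> {1..N}" "j \<in> {1..N}" for i j
    using comp[OF that(1)] comp[OF that(2)] \<Delta> by measurable
  have ind: "integrable P (\<lambda>\<omega>. indicator \<Delta> (norm (X \<omega> i - X \<omega> j)) :: real)"
    "(\<integral>\<omega>. indicator \<Delta> (norm (X \<omega> i - X \<omega> j)) \<partial>P) = measure P {\<omega> \<in> space P. norm (X \<omega> i - X \<omega> j) \<in> \<Delta>}"
    if "i \<in> {1..N}" "j \<in> {1..N}" for i j
  proof -
    have eq: "indicator \<Delta> (norm (X \<omega> i - X \<omega> j)) =
        (indicator {\<omega> \<in> space P. norm (X \<omega> i - X \<omega> j) \<in> \<Delta>} \<omega> :: real)" if "\<omega> \<in> space P" for \<omega>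
      using that by (auto simp: indicator_def)
    show "integrable P (\<lambda>\<omega>. indicator \<Delta> (norm (X \<omega> i - X \<omega> j)) :: real)"
      using ev[OF that] by (subst Bochner_Integration.integrable_cong[OF refl eq]) (auto simp: emeasure_eq_measure)
    show "(\<integral>\<omega>. indicator \<Delta> (norm (X \<omega> i - X \<omega> j)) \<partial>P) = measure P {\<omega> \<in> space P. norm (X \<omega> i - X \<omega> j) \<in> \<Delta>}"
      using ev[OF that] by (subst Bochner_Integration.integral_cong[OF refl eq]) auto
  qed
  have V: "V \<omega> \<le> B\<^sup>2 / (real N - 1) * S \<omega>" for \<omega>
    unfolding V_def S_def sum_distrib_left[of _ _ "{1..N}"]
  proof (rule sum_mono)
    fix i assume "i \<in> {1..N}"
    from interaction_diff_norm_sq[OF N this B]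
    show "(norm (interaction N \<phi> (X \<omega>) i - interaction N \<phi>' (X \<omega>) i))\<^sup>2 \<le>
      B\<^sup>2 / (real N - 1) * (\<Sum>j\<in>{1..N} - {i}. indicator \<Delta> (norm (X \<omega> i - X \<omega> j)))" .
  qed
  have iS: "integrable P S" unfolding S_def[abs_def]
    by (rule Bochner_Integration.integrable_sum, rule Bochner_Integration.integrable_sum, rule ind(1)) auto
  have mV: "V \<in> borel_measurable P"
    unfolding V_def[abs_def]
  proof (rule borel_measurable_sum)
    fix i assume i: "i \<in> {1..N}"
    have "(\<lambda>\<omega>. interaction N \<phi> (X \<omega>) i - interaction N \<phi>' (X \<omega>) i) \<in> borel_measurable P"
      by (intro borel_measurable_diff interaction_measurable X \<phi> i)
    then show "(\<lambda>\<omega>. (norm (interaction N \<phi> (X \<omega>) i - interaction N \<phi>' (X \<omega>) i))\<^sup>2) \<in> borel_measurable P"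
      by measurable
  qed
  have iS': "integrable P (\<lambda>\<omega>. B\<^sup>2 / (real N - 1) * S \<omega>)"
    by (rule integrable_mult_right[OF iS])
  have boundV: "AE \<omega> in P. norm (V \<omega>) \<le> norm (B\<^sup>2 / (real N - 1) * S \<omega>)"
  proof (rule AE_I2)
    fix \<omega>
    have "0 \<le> V \<omega>" by (simp add: V_def sum_nonneg)
    then show "norm (V \<omega>) \<le> norm (B\<^sup>2 / (real N - 1) * S \<omega>)"
      using V[of \<omega>] unfolding real_norm_def by linarith
  qed
  have iV: "integrable P V"
    by (rule Bochner_Integration.integrable_bound[OF iS' mV boundV])
  have nn: "0 \<le> (\<Sum>i\<in>{1..N}. \<Sum>j\<in>{1..N} - {i}. measure P {\<omega> \<in> space P. norm (X \<omega> i - X \<omega> j) \<in> \<Delta>})"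
    by (intro sum_nonneg) auto
  have "(\<integral>\<omega>. V \<omega> \<partial>P) \<le> (\<integral>\<omega>. B\<^sup>2 / (real N - 1) * S \<omega> \<partial>P)"
    by (rule integral_mono[OF iV iS' V])
  also have "\<dots> = B\<^sup>2 / (real N - 1) * (\<integral>\<omega>. S \<omega> \<partial>P)" by (rule integral_mult_right_zero)
  also have "(\<integral>\<omega>. S \<omega> \<partial>P) = (\<Sum>i\<in>{1..N}. \<Sum>j\<in>{1..N} - {i}. measure P {\<omega> \<in> space P. norm (X \<omega> i - X \<omega> j) \<in> \<Delta>})"
  proof -
    have "(\<integral>\<omega>. S \<omega> \<partial>P) =
        (\<Sum>i\<in>{1..N}. \<integral>\<omega>. (\<Sum>j\<in>{1..N} - {i}. indicator \<Delta> (norm (X \<omega> i - X \<omega> j))) \<partial>P)"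
      unfolding S_def
      by (rule Bochner_Integration.integral_sum, rule Bochner_Integration.integrable_sum, rule ind(1)) auto
    also have "\<dots> = (\<Sum>i\<in>{1..N}. \<Sum>j\<in>{1..N} - {i}. \<integral>\<omega>. indicator \<Delta> (norm (X \<omega> i - X \<omega> j)) \<partial>P)"
      by (rule sum.cong[OF refl], rule Bochner_Integration.integral_sum, rule ind(1)) auto
    also have "\<dots> = (\<Sum>i\<in>{1..N}. \<Sum>j\<in>{1..N} - {i}. measure P {\<omega> \<in> space P. norm (X \<omega> i - X \<omega> j) \<in> \<Delta>})"
      by (rule sum.cong[OF refl], rule sum.cong[OF refl], rule ind(2)) auto
    finally show ?thesis .
  qed
  also have "B\<^sup>2 / (real N - 1) *
      (\<Sum>i\<in>{1..N}. \<Sum>j\<in>{1..N} - {i}. measure P {\<omega> \<in> space P. norm (X \<omega> i - X \<omega> j) \<in> \<Delta>}) =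
      real N * B\<^sup>2 * measure (exploration P N X) \<Delta>"
  proof -
    define q where "q = (\<Sum>i\<in>{1..N}. \<Sum>j\<in>{1..N} - {i}. measure P {\<omega> \<in> space P. norm (X \<omega> i - X \<omega> j) \<in> \<Delta>})"
    have "measure (exploration P N X) \<Delta> = 1 / (real N * (real N - 1)) * q"
      using emeasure_exploration[OF P X N \<Delta>] nn N by (simp add: measure_def q_def)
    moreover have "0 < n \<Longrightarrow> B\<^sup>2 / m * q = n * B\<^sup>2 * (1 / (n * m) * q)" for n m :: real by (cases "m = 0") auto
    ultimately show ?thesis using N by (simp only: q_def)
  qed
  finally show "(\<integral>\<omega>. (\<Sum>i\<in>{1..N}. (norm (interaction N \<phi> (X \<omega>) i - interaction N \<phi>' (X \<omega>) i))\<^sup>2) \<partial>P)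
      \<le> real N * B\<^sup>2 * measure (exploration P N X) \<Delta>" unfolding V_def .
  show "integrable P (\<lambda>\<omega>. \<Sum>i\<in>{1..N}. (norm (interaction N \<phi> (X \<omega>) i - interaction N \<phi>' (X \<omega>) i))\<^sup>2)"
    using iV unfolding V_def[abs_def] .
qed

lemma finite_measure_exploration:
  fixes X \<eta> :: "'a \<Rightarrow> nat \<Rightarrow> real ^ 'd"
  assumes model: "interaction_model P N X \<eta> p \<rho>'" and N: "3 \<le> N"
  shows "finite_measure (exploration P N X)"
proof -
  have P: "prob_space P" and "prob_space.indep_var P (config_space N) X (config_space N) \<eta>"
    using model unfolding interaction_model_def by auto
  then have X: "X \<in> measurable P (config_space N)"
    unfolding prob_space.indep_var_distribution_eq[OF P] by auto
  have "emeasure (exploration P N X) UNIV \<noteq> \<infinity>"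
    by (subst emeasure_exploration[OF P X N]) auto
  then show ?thesis
    by (intro finite_measureI) (simp add: exploration_def space_measure_of_conv)
qed

section \<open>The likelihood ratio of one sample\<close>

lemma sample_law_eq_distr:
  fixes X \<eta> :: "'a \<Rightarrow> nat \<Rightarrow> real ^ 'd" and p :: "(nat \<Rightarrow> real ^ 'd) \<Rightarrow> real"
  assumes P: "prob_space P"
    and indep: "prob_space.indep_var P (config_space N) X (config_space N) \<eta>"
    and p: "distributed P (config_lborel N) \<eta> (\<lambda>u. ennreal (p u))"
    and \<phi>[measurable]: "\<phi> \<in> borel_measurable borel"
  shows "sample_law P N X \<eta> \<phi> =
    distr (distr P (config_space N) X \<Otimes>\<^sub>M density (config_lborel N) (\<lambda>u. ennreal (p u)))
      (config_space N \<Otimes>\<^sub>M config_space N) (\<lambda>(x, u). (x, config_plus N (drift N \<phi> x) u))"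
proof -
  interpret prob_space P by fact
  have [measurable]: "X \<in> measurable P (config_space N)" "\<eta> \<in> measurable P (config_space N)"
    and joint: "distr P (config_space N) X \<Otimes>\<^sub>M distr P (config_space N) \<eta> =
      distr P (config_space N \<Otimes>\<^sub>M config_space N) (\<lambda>\<omega>. (X \<omega>, \<eta> \<omega>))"
    using indep unfolding indep_var_distribution_eq by auto
  have noise: "distr P (config_space N) \<eta> = density (config_lborel N) (\<lambda>u. ennreal (p u))"
    using distributed_distr_eq_density[OF p] distr_cong[OF refl sets_config_lborel, of P \<eta> \<eta>] by simp
  have m: "(\<lambda>(x, u). (x, config_plus N (drift N \<phi> x) u)) \<in>
      measurable (config_space N \<Otimes>\<^sub>M config_space N) (config_space N \<Otimes>\<^sub>M config_space N)"
    by measurable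
  show ?thesis
    unfolding noise[symmetric] joint by (subst distr_distr[OF m])
      (auto simp: sample_law_def comp_def observation_eq)
qed

lemma ln_divide_swap: "- ln (a / b) = ln (b / a :: real)" if "0 \<le> a" "0 \<le> b"
  using that by (cases "a = 0 \<or> b = 0") (auto simp: ln_div)

text \<open>
  Given the positions \<open>x\<close>, changing the kernel translates the noise by \<open>v x\<close>, the difference of
  the two interaction fields. The likelihood ratio is therefore \<open>p (u + v x) / p u\<close>, and the assumption
  on the noise bounds the conditional divergence by \<open>c\<close> times the squared norm of \<open>v x\<close>. Averaging
  over the positions gives the divergence of one sample.
\<close>

lemma likelihood_ratio_sample_law:
  fixes X \<eta> :: "'a \<Rightarrow> nat \<Rightarrow> real ^ 'd" and p :: "(nat \<Rightarrow> real ^ 'd) \<Rightarrow> real"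
  assumes P: "prob_space P"
    and indep: "prob_space.indep_var P (config_space N) X (config_space N) \<eta>"
    and p0: "\<And>u. u \<in> space (config_space N) \<Longrightarrow> 0 \<le> p u"
    and p: "distributed P (config_lborel N) \<eta> (\<lambda>u. ennreal (p u))"
    and KL: "shift_KL_bound N p c"
    and \<phi>[measurable]: "\<phi> \<in> borel_measurable borel" "\<phi>' \<in> borel_measurable borel"
    and iV: "integrable P (\<lambda>\<omega>. \<Sum>i\<in>{1..N}. (norm (interaction N \<phi> (X \<omega>) i - interaction N \<phi>' (X \<omega>) i))\<^sup>2)"
  shows "\<exists>w. likelihood_ratio (sample_law P N X \<eta> \<phi>) (sample_law P N X \<eta> \<phi>') w
    (c * (\<integral>\<omega>. (\<Sum>i\<in>{1..N}. (norm (interaction N \<phi> (X \<omega>) i - interaction N \<phi>' (X \<omega>) i))\<^sup>2) \<partial>P))"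
proof -
  interpret prob_space P by fact
  let ?C = "config_space N :: (nat \<Rightarrow> real ^ 'd) measure"
  define r :: "(nat \<Rightarrow> real ^ 'd) \<Rightarrow> nat \<Rightarrow> real ^ 'd" where "r = drift N \<phi>"
  define r' :: "(nat \<Rightarrow> real ^ 'd) \<Rightarrow> nat \<Rightarrow> real ^ 'd" where "r' = drift N \<phi>'"
  define w where "w = (\<lambda>(x, y). p (config_minus N y (drift N \<phi>' x)) / p (config_minus N y (drift N \<phi> x)))"
  define \<mu> where "\<mu> = distr P ?C X"
  define \<nu> where "\<nu> = density (config_lborel N) (\<lambda>u. ennreal (p u))"
  have [measurable]: "X \<in> measurable P ?C" "\<eta> \<in> measurable P (config_lborel N)"
    using indep distributed_measurable[OF p] unfolding indep_var_distribution_eq by auto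
  interpret \<mu>: prob_space \<mu> unfolding \<mu>_def by (rule prob_space_distr) measurable
  have \<nu>_distr: "\<nu> = distr P (config_lborel N) \<eta>"
    using distributed_distr_eq_density[OF p] by (simp add: \<nu>_def)
  interpret \<nu>: prob_space \<nu> unfolding \<nu>_distr by (rule prob_space_distr) measurable
  interpret \<mu>\<nu>: pair_prob_space \<mu> \<nu> ..
  have [measurable_cong]: "sets \<mu> = sets ?C" "sets \<nu> = sets ?C"
    by (simp_all add: \<mu>_def \<nu>_def sets_config_lborel)
  have sp\<mu>: "space \<mu> = space ?C"
    by (simp_all add: \<mu>_def \<nu>_def space_config_lborel)
  have ep[measurable]: "(\<lambda>u. ennreal (p u)) \<in> borel_measurable ?C"
    using distributed_borel_measurable[OF p] by (simp add: measurable_cong_sets[OF sets_config_lborel refl])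
  have "(\<lambda>u. enn2real (ennreal (p u))) \<in> borel_measurable ?C" by measurable
  then have pm[measurable]: "p \<in> borel_measurable ?C"
    by (rule measurable_cong[THEN iffD1, rotated]) (simp add: p0)
  have pnn: "0 \<le> p (config_minus N y z)" "0 \<le> p (config_plus N y z)" for y z by (simp_all add: p0)
  have law: "sample_law P N X \<eta> \<psi> =
      distr (\<mu> \<Otimes>\<^sub>M \<nu>) (?C \<Otimes>\<^sub>M ?C) (\<lambda>(x, u). (x, config_plus N (drift N \<psi> x) u))"
    if "\<psi> \<in> borel_measurable borel" for \<psi>
    unfolding \<mu>_def \<nu>_def by (rule sample_law_eq_distr[OF P indep p that])
  have nnlaw: "(\<integral>\<^sup>+z. G z \<partial>sample_law P N X \<eta> \<psi>) =
      (\<integral>\<^sup>+x. (\<integral>\<^sup>+u. ennreal (p u) * G (x, config_plus N (drift N \<psi> x) u) \<partial>config_lborel N) \<partial>\<mu>)"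
    if [measurable]: "\<psi> \<in> borel_measurable borel" "G \<in> borel_measurable (?C \<Otimes>\<^sub>M ?C)" for \<psi> G
  proof -
    have [measurable]: "(\<lambda>(x, u). G (x, config_plus N (drift N \<psi> x) u)) \<in> borel_measurable (?C \<Otimes>\<^sub>M ?C)"
      by measurable
    have "(\<integral>\<^sup>+z. G z \<partial>sample_law P N X \<eta> \<psi>) =
        (\<integral>\<^sup>+z. (\<lambda>(x, u). G (x, config_plus N (drift N \<psi> x) u)) z \<partial>(\<mu> \<Otimes>\<^sub>M \<nu>))"
      unfolding law[OF that(1)] by (subst nn_integral_distr) (auto simp: split_beta')
    also have "\<dots> = (\<integral>\<^sup>+x. (\<integral>\<^sup>+u. G (x, config_plus N (drift N \<psi> x) u) \<partial>\<nu>) \<partial>\<mu>)"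
      by (subst \<nu>.nn_integral_fst[symmetric]) auto
    also have "\<dots> = (\<integral>\<^sup>+x. (\<integral>\<^sup>+u. ennreal (p u) * G (x, config_plus N (drift N \<psi> x) u) \<partial>config_lborel N) \<partial>\<mu>)"
    proof (rule nn_integral_cong)
      fix x assume "x \<in> space \<mu>"
      then have [measurable]: "x \<in> space ?C" by (simp add: sp\<mu>)
      show "(\<integral>\<^sup>+u. G (x, config_plus N (drift N \<psi> x) u) \<partial>\<nu>) =
          (\<integral>\<^sup>+u. ennreal (p u) * G (x, config_plus N (drift N \<psi> x) u) \<partial>config_lborel N)"
        unfolding \<nu>_def by (subst nn_integral_density) auto
    qed
    finally show ?thesis .
  qed
  define v where "v x = config_minus N (r x) (r' x)" for x
  have [measurable]: "v \<in> measurable ?C ?C" "r \<in> measurable ?C ?C" "r' \<in> measurable ?C ?C"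
    unfolding v_def r_def r'_def by measurable
  have wT: "w (x, config_plus N (r x) u) = p (config_plus N u (v x)) / p u" if "u \<in> space ?C" for x u
    using config_minus_plus[OF that] by (simp add: w_def v_def r_def r'_def)
  have wm[measurable]: "w \<in> borel_measurable (?C \<Otimes>\<^sub>M ?C)" unfolding w_def by measurable
  have w0: "0 \<le> w z" for z by (cases z) (simp add: w_def pnn)
  \<comment> \<open>Substituting \<open>u + v x\<close> for \<open>u\<close>; mass of \<open>p (u + v x)\<close> where \<open>p u = 0\<close> is lost.\<close>
  have dom: "(\<integral>\<^sup>+z. ennreal (w z) * G z \<partial>sample_law P N X \<eta> \<phi>) \<le> (\<integral>\<^sup>+z. G z \<partial>sample_law P N X \<eta> \<phi>')"
    if G[measurable]: "G \<in> borel_measurable (?C \<Otimes>\<^sub>M ?C)" for G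
  proof -
    have "(\<integral>\<^sup>+z. ennreal (w z) * G z \<partial>sample_law P N X \<eta> \<phi>) =
       (\<integral>\<^sup>+x. (\<integral>\<^sup>+u. ennreal (p u) * (ennreal (w (x, config_plus N (r x) u)) * G (x, config_plus N (r x) u)) \<partial>config_lborel N) \<partial>\<mu>)"
      unfolding r_def by (rule nnlaw) auto
    also have "\<dots> \<le> (\<integral>\<^sup>+x. (\<integral>\<^sup>+u. ennreal (p u) * G (x, config_plus N (r' x) u) \<partial>config_lborel N) \<partial>\<mu>)"
    proof (rule nn_integral_mono)
      fix x assume "x \<in> space \<mu>"
      then have [measurable]: "x \<in> space ?C" by (simp add: sp\<mu>)
      have "(\<integral>\<^sup>+u. ennreal (p u) * (ennreal (w (x, config_plus N (r x) u)) * G (x, config_plus N (r x) u)) \<partial>config_lborel N)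
        \<le> (\<integral>\<^sup>+u. (\<lambda>u. ennreal (p u) * G (x, config_plus N (r' x) u)) (config_plus N u (v x)) \<partial>config_lborel N)"
      proof (rule nn_integral_mono)
        fix u :: "nat \<Rightarrow> real ^ 'd" assume "u \<in> space (config_lborel N)"
        then have u: "u \<in> space ?C" by (simp add: space_config_lborel)
        have "ennreal (p u) * ennreal (w (x, config_plus N (r x) u)) \<le> ennreal (p (config_plus N u (v x)))"
          unfolding wT[OF u] using p0[OF u] pnn by (subst ennreal_mult'[symmetric]) (auto intro!: ennreal_leI)
        moreover have "config_plus N (r x) u = config_plus N (r' x) (config_plus N u (v x))"
          using config_minus_plus(3)[OF u] by (simp add: v_def)
        ultimately show "ennreal (p u) * (ennreal (w (x, config_plus N (r x) u)) * G (x, config_plus N (r x) u))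
          \<le> (\<lambda>u. ennreal (p u) * G (x, config_plus N (r' x) u)) (config_plus N u (v x))"
          by (simp add: mult.assoc[symmetric] mult_right_mono)
      qed
      also have "\<dots> = (\<integral>\<^sup>+u. ennreal (p u) * G (x, config_plus N (r' x) u) \<partial>config_lborel N)"
        by (rule nn_integral_config_lborel_plus) (auto simp: v_def)
      finally show "(\<integral>\<^sup>+u. ennreal (p u) * (ennreal (w (x, config_plus N (r x) u)) * G (x, config_plus N (r x) u)) \<partial>config_lborel N)
        \<le> (\<integral>\<^sup>+u. ennreal (p u) * G (x, config_plus N (r' x) u) \<partial>config_lborel N)" .
    qed
    also have "\<dots> = (\<integral>\<^sup>+z. G z \<partial>sample_law P N X \<eta> \<phi>')"
      unfolding r'_def by (rule nnlaw[symmetric]) auto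
    finally show ?thesis .
  qed
  \<comment> \<open>The log-likelihood ratio and the ratio itself, as functions of positions and noise.\<close>
  define f where "f = (\<lambda>(x, u). - ln (w (x, config_plus N (r x) u)))"
  define g where "g = (\<lambda>(x, u). w (x, config_plus N (r x) u))"
  have [measurable]: "f \<in> borel_measurable (?C \<Otimes>\<^sub>M ?C)" "g \<in> borel_measurable (?C \<Otimes>\<^sub>M ?C)"
    unfolding f_def g_def by measurable
  define V :: "(nat \<Rightarrow> real ^ 'd) \<Rightarrow> real" where "V x = (\<Sum>i\<in>{1..N}. (norm (interaction N \<phi> x i - interaction N \<phi>' x i))\<^sup>2)" for x
  have KLx: "AE u in config_lborel N. 0 < p u \<longrightarrow> 0 < p (config_plus N u (v x))"
    "integrable (config_lborel N) (\<lambda>u. p u * ln (p u / p (config_plus N u (v x))))"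
    "(\<integral>u. p u * ln (p u / p (config_plus N u (v x))) \<partial>config_lborel N) \<le> c * V x" for x
  proof -
    have "v x \<in> space ?C" by (simp add: v_def)
    moreover have "(\<Sum>i\<in>{1..N}. (norm (v x i))\<^sup>2) = V x"
      by (simp add: V_def v_def config_minus_def r_def r'_def drift_def)
    ultimately show "AE u in config_lborel N. 0 < p u \<longrightarrow> 0 < p (config_plus N u (v x))"
    "integrable (config_lborel N) (\<lambda>u. p u * ln (p u / p (config_plus N u (v x))))"
    "(\<integral>u. p u * ln (p u / p (config_plus N u (v x))) \<partial>config_lborel N) \<le> c * V x"
      using KL unfolding shift_KL_bound_def config_plus_def Let_def by auto
  qed
  have posx: "AE u in \<nu>. 0 < g (x, u)" for x
    unfolding \<nu>_def
    by (subst AE_density, measurable)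
      (use KLx(1)[of x] AE_space[of "config_lborel N"] in
        \<open>eventually_elim, auto simp: space_config_lborel g_def wT\<close>)
  have fx: "integrable \<nu> (\<lambda>u. f (x, u))" "(\<integral>u. f (x, u) \<partial>\<nu>) \<le> c * V x" if "x \<in> space ?C" for x
  proof -
    have [measurable]: "x \<in> space ?C" by fact
    have eq: "p u *\<^sub>R f (x, u) = p u * ln (p u / p (config_plus N u (v x)))" if "u \<in> space (config_lborel N)" for u
      using that by (simp add: f_def wT ln_divide_swap p0 space_config_lborel)
    have nn: "AE u in config_lborel N. 0 \<le> p u" by (rule AE_I2) (simp add: p0 space_config_lborel)
    have [measurable]: "(\<lambda>u. f (x, u)) \<in> borel_measurable (config_lborel N)" by measurable
    have [measurable]: "p \<in> borel_measurable (config_lborel N)" by measurable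
    have "integrable (config_lborel N) (\<lambda>u. p u *\<^sub>R f (x, u)) \<longleftrightarrow>
        integrable (config_lborel N) (\<lambda>u. p u * ln (p u / p (config_plus N u (v x))))"
      by (rule Bochner_Integration.integrable_cong[OF refl]) (rule eq)
    then have i: "integrable (config_lborel N) (\<lambda>u. p u *\<^sub>R f (x, u))"
      using KLx(2)[of x] by (rule iffD2)
    have "integrable \<nu> (\<lambda>u. f (x, u)) \<longleftrightarrow> integrable (config_lborel N) (\<lambda>u. p u *\<^sub>R f (x, u))"
      unfolding \<nu>_def by (rule integrable_density[OF _ _ nn]) fact+
    then show "integrable \<nu> (\<lambda>u. f (x, u))" using i by (rule iffD2)
    have "(\<integral>u. f (x, u) \<partial>\<nu>) = (\<integral>u. p u *\<^sub>R f (x, u) \<partial>config_lborel N)"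
      unfolding \<nu>_def by (rule integral_density[OF _ _ nn]) fact+
    also have "\<dots> = (\<integral>u. p u * ln (p u / p (config_plus N u (v x))) \<partial>config_lborel N)"
      by (rule Bochner_Integration.integral_cong[OF refl]) (rule eq)
    finally show "(\<integral>u. f (x, u) \<partial>\<nu>) \<le> c * V x" using KLx(3)[of x] by simp
  qed
  have gx: "integrable \<nu> (\<lambda>u. g (x, u))" "(\<integral>u. g (x, u) \<partial>\<nu>) \<le> 1" if "x \<in> space ?C" for x
  proof -
    have [measurable]: "x \<in> space ?C" by fact
    have "(\<integral>\<^sup>+u. ennreal (g (x, u)) \<partial>\<nu>) = (\<integral>\<^sup>+u. ennreal (p u) * ennreal (g (x, u)) \<partial>config_lborel N)"
      unfolding \<nu>_def by (rule nn_integral_density) measurable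
    also have "\<dots> \<le> (\<integral>\<^sup>+u. ennreal (p (config_plus N u (v x))) \<partial>config_lborel N)"
    proof (rule nn_integral_mono)
      fix u :: "nat \<Rightarrow> real ^ 'd" assume "u \<in> space (config_lborel N)"
      then have u: "u \<in> space ?C" by (simp add: space_config_lborel)
      show "ennreal (p u) * ennreal (g (x, u)) \<le> ennreal (p (config_plus N u (v x)))"
        unfolding g_def using p0[OF u] pnn wT[OF u]
        by (subst ennreal_mult'[symmetric]) (auto intro!: ennreal_leI)
    qed
    also have "\<dots> = (\<integral>\<^sup>+u. ennreal (p u) \<partial>config_lborel N)"
      by (rule nn_integral_config_lborel_plus) (auto simp: v_def)
    also have "\<dots> = 1"
      using \<nu>.emeasure_space_1 unfolding \<nu>_def by (subst (asm) emeasure_density) auto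
    finally have le: "(\<integral>\<^sup>+u. ennreal (g (x, u)) \<partial>\<nu>) \<le> ennreal 1" by simp
    then have "(\<integral>\<^sup>+u. ennreal (g (x, u)) \<partial>\<nu>) < \<infinity>" using le_less_trans by fastforce
    moreover have g0: "0 \<le> g (x, u)" for u by (simp add: g_def w0)
    ultimately show int: "integrable \<nu> (\<lambda>u. g (x, u))"
      by (intro integrableI_nonneg) auto
    show "(\<integral>u. g (x, u) \<partial>\<nu>) \<le> 1"
      using le by (subst (asm) nn_integral_eq_integral[OF int]) (auto simp: g0 simp flip: ennreal_1)
  qed
  \<comment> \<open>Needed for Fubini: the positive part of \<open>ln g\<close> is at most \<open>g\<close>, so its mean is at most 1.\<close>
  have absx: "(\<integral>u. norm (f (x, u)) \<partial>\<nu>) \<le> c * V x + 2" if x: "x \<in> space ?C" for x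
  proof -
    have "(\<integral>u. norm (f (x, u)) \<partial>\<nu>) \<le> (\<integral>u. f (x, u) + 2 * g (x, u) \<partial>\<nu>)"
    proof (rule integral_mono_AE)
      show "AE u in \<nu>. norm (f (x, u)) \<le> f (x, u) + 2 * g (x, u)"
        using posx[of x]
      proof eventually_elim
        case (elim u)
        have "ln (g (x, u)) \<le> g (x, u)" using ln_le_minus_one[OF elim] by simp
        moreover have "f (x, u) = - ln (g (x, u))" by (simp add: f_def g_def)
        ultimately show ?case using elim unfolding real_norm_def by linarith
      qed
    qed (use fx(1)[OF x] gx(1)[OF x] in auto)
    also have "\<dots> \<le> c * V x + 2" using fx[OF x] gx[OF x] by simp
    finally show ?thesis .
  qed
  have Vm[measurable]: "V \<in> borel_measurable ?C"
    unfolding V_def[abs_def]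
  proof (rule borel_measurable_sum)
    fix i assume i: "i \<in> {1..N}"
    have "(\<lambda>x. interaction N \<phi> x i - interaction N \<phi>' x i) \<in> borel_measurable ?C"
      by (intro borel_measurable_diff interaction_measurable measurable_ident_sets \<phi> i refl)
    then show "(\<lambda>x. (norm (interaction N \<phi> x i - interaction N \<phi>' x i))\<^sup>2) \<in> borel_measurable ?C"
      by measurable
  qed
  have iV\<mu>: "integrable \<mu> V" unfolding \<mu>_def
    by (subst integrable_distr_eq) (use iV in \<open>auto simp: V_def\<close>)
  have EV: "(\<integral>x. V x \<partial>\<mu>) =
      (\<integral>\<omega>. (\<Sum>i\<in>{1..N}. (norm (interaction N \<phi> (X \<omega>) i - interaction N \<phi>' (X \<omega>) i))\<^sup>2) \<partial>P)"
    unfolding \<mu>_def by (subst integral_distr) (auto simp: V_def)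
  have fint: "integrable (\<mu> \<Otimes>\<^sub>M \<nu>) f"
  proof (rule \<mu>\<nu>.Fubini_integrable)
    show "integrable \<mu> (\<lambda>x. \<integral>u. norm (f (x, u)) \<partial>\<nu>)"
    proof (rule Bochner_Integration.integrable_bound)
      show "integrable \<mu> (\<lambda>x. c * V x + 2)" using iV\<mu> by auto
      show "AE x in \<mu>. norm (\<integral>u. norm (f (x, u)) \<partial>\<nu>) \<le> norm (c * V x + 2)"
      proof (rule AE_I2)
        fix x assume "x \<in> space \<mu>"
        then have "(\<integral>u. norm (f (x, u)) \<partial>\<nu>) \<le> c * V x + 2" using absx by (simp add: sp\<mu>)
        moreover have "0 \<le> (\<integral>u. norm (f (x, u)) \<partial>\<nu>)" by (rule integral_nonneg_AE) simp
        ultimately show "norm (\<integral>u. norm (f (x, u)) \<partial>\<nu>) \<le> norm (c * V x + 2)"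
          unfolding real_norm_def by linarith
      qed
    qed measurable
    show "AE x in \<mu>. integrable \<nu> (\<lambda>u. f (x, u))"
      by (rule AE_I2) (simp add: fx sp\<mu>)
  qed measurable
  have "(\<integral>z. f z \<partial>(\<mu> \<Otimes>\<^sub>M \<nu>)) = (\<integral>x. (\<integral>u. f (x, u) \<partial>\<nu>) \<partial>\<mu>)"
    by (rule \<mu>\<nu>.integral_fst'[OF fint, symmetric])
  also have "\<dots> \<le> (\<integral>x. c * V x \<partial>\<mu>)"
    by (rule integral_mono) (use \<mu>\<nu>.integrable_fst'[OF fint] iV\<mu> fx in \<open>auto simp: sp\<mu>\<close>)
  finally have Ef: "(\<integral>z. f z \<partial>(\<mu> \<Otimes>\<^sub>M \<nu>)) \<le> c * (\<integral>x. V x \<partial>\<mu>)" by simp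
  have mT\<phi>: "(\<lambda>(x, u). (x, config_plus N (drift N \<phi> x) u)) \<in> measurable (\<mu> \<Otimes>\<^sub>M \<nu>) (?C \<Otimes>\<^sub>M ?C)"
    by measurable
  have sl: "sets (sample_law P N X \<eta> \<phi>) = sets (?C \<Otimes>\<^sub>M ?C)" by (simp add: sample_law_def)
  have lnT: "ln (w (case z of (x, u) \<Rightarrow> (x, config_plus N (drift N \<phi> x) u))) = - f z" for z
    by (cases z) (simp add: f_def r_def)
  have lnw: "(\<lambda>z. ln (w z)) \<in> borel_measurable (?C \<Otimes>\<^sub>M ?C)" "(\<lambda>z. - ln (w z)) \<in> borel_measurable (?C \<Otimes>\<^sub>M ?C)"
    using wm by measurable
  have "integrable (sample_law P N X \<eta> \<phi>) (\<lambda>z. ln (w z))"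
    unfolding law[OF \<phi>(1)] integrable_distr_eq[OF mT\<phi> lnw(1)] lnT
    by (rule Bochner_Integration.integrable_minus[OF fint])
  moreover have "(\<integral>z. - ln (w z) \<partial>sample_law P N X \<eta> \<phi>) \<le> c * (\<integral>x. V x \<partial>\<mu>)"
    unfolding law[OF \<phi>(1)] integral_distr[OF mT\<phi> lnw(2)] lnT using Ef by simp
  moreover have "AE z in sample_law P N X \<eta> \<phi>. 0 < w z"
    unfolding law[OF \<phi>(1)]
  proof (subst AE_distr_iff[OF mT\<phi>])
    have "AE z in \<mu> \<Otimes>\<^sub>M \<nu>. 0 < g z"
      by (rule \<mu>\<nu>.AE_pair_measure) (auto simp: posx)
    then show "AE z in \<mu> \<Otimes>\<^sub>M \<nu>. 0 < w (case z of (x, u) \<Rightarrow> (x, config_plus N (drift N \<phi> x) u))"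
      by (simp add: g_def r_def split_beta')
  qed measurable
  ultimately have "likelihood_ratio (sample_law P N X \<eta> \<phi>) (sample_law P N X \<eta> \<phi>') w (c * (\<integral>x. V x \<partial>\<mu>))"
    unfolding likelihood_ratio_def using dom w0 wm by (simp add: measurable_cong_sets[OF sl refl])
  then show ?thesis unfolding EV by blast
qed

section \<open>Trains of bumps in the Hoelder class\<close>

text \<open>
  The bump is \<open>(t (1 - t)) ^ (l + 1)\<close> on the unit interval and zero elsewhere. The exponent makes the
  first \<open>l\<close> derivatives vanish at both end points, so that the extension by zero is \<open>l\<close> times
  differentiable with a Lipschitz continuous \<open>l\<close>-th derivative.
  \<open>bump l j\<close> is its \<open>j\<close>-th derivative for \<open>j \<le> l\<close>.
\<close>

definition bump_poly :: "nat \<Rightarrow> real poly" where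
  "bump_poly l = [:0, 1, -1:] ^ Suc l"

definition bump :: "nat \<Rightarrow> nat \<Rightarrow> real \<Rightarrow> real" where
  "bump l j t = (if t \<in> {0..1} then poly ((pderiv ^^ j) (bump_poly l)) t else 0)"

lemma power_dvd_pderiv:
  fixes p q :: "real poly"
  assumes "q ^ Suc n dvd p"
  shows "q ^ n dvd pderiv p"
proof -
  obtain r where "p = q ^ Suc n * r" using assms by (elim dvdE)
  then have "pderiv p = q ^ n * (q * pderiv r + smult (of_nat (Suc n)) (pderiv q) * r)"
    by (simp only: pderiv_mult pderiv_power_Suc) (simp add: algebra_simps)
  then show ?thesis by (metis dvd_triv_left)
qed

lemma bump_poly_boundary:
  assumes "j \<le> l" "t = 0 \<or> t = 1"
  shows "poly ((pderiv ^^ j) (bump_poly l)) t = 0"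
proof -
  have "[:0, 1, -1:] ^ (Suc l - j) dvd (pderiv ^^ j) (bump_poly l)"
    using assms(1)
  proof (induction j)
    case (Suc j)
    then have "[:0, 1, -1:] ^ Suc (l - j) dvd (pderiv ^^ j) (bump_poly l)"
      by (simp add: Suc_diff_le)
    from power_dvd_pderiv[OF this] show ?case by simp
  qed (simp add: bump_poly_def)
  then have "[:0, 1, -1:] dvd (pderiv ^^ j) (bump_poly l)"
    using assms(1) by (elim dvd_trans[rotated]) (rule dvd_power, auto)
  then obtain r where "(pderiv ^^ j) (bump_poly l) = [:0, 1, -1:] * r" by (elim dvdE)
  then show ?thesis using assms(2) by auto
qed

lemma bump_eq_0: "bump l j t = 0" if "j \<le> l" "t \<le> 0 \<or> 1 \<le> t"
  using that bump_poly_boundary[of j l t] unfolding bump_def by (cases "t = 0 \<or> t = 1") auto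

lemma bump_0_eq: "bump l 0 t = (if t \<in> {0..1} then (t * (1 - t)) ^ Suc l else 0)"
  unfolding bump_def bump_poly_def by (simp add: poly_power algebra_simps)

lemma has_field_derivative_within_Un:
  assumes "(f has_field_derivative D) (at x within S)" "(f has_field_derivative D) (at x within T)"
  shows "(f has_field_derivative D) (at x within S \<union> T)"
  using assms unfolding has_field_derivative_iff Lim_within_Un by blast

text \<open>
  At the two junctions the derivatives from both sides vanish.
\<close>

lemma bump_has_derivative:
  assumes "j < l"
  shows "(bump l j has_real_derivative bump l (Suc j) t) (at t)"
proof -
  define p where "p = (pderiv ^^ j) (bump_poly l)"
  have p: "(poly p has_real_derivative poly (pderiv p) x) (at x)" for x by (rule poly_DERIV)
  have p': "pderiv p = (pderiv ^^ Suc j) (bump_poly l)" by (simp add: p_def)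
  have on: "bump l j x = poly p x" if "x \<in> {0..1}" for x using that by (simp add: bump_def p_def)
  have off: "bump l j x = 0" if "x \<le> 0 \<or> 1 \<le> x" for x using bump_eq_0 assms that by auto
  have on': "bump l (Suc j) x = poly (pderiv p) x" if "x \<in> {0..1}" for x
    using that by (simp add: bump_def p')
  have off': "bump l (Suc j) x = 0" if "x \<le> 0 \<or> 1 \<le> x" for x using bump_eq_0 assms that by auto
  have inside: "(bump l j has_real_derivative bump l (Suc j) x) (at x within {0..1})"
    if "x \<in> {0..1}" for x
    using that on by (subst on'[OF that], intro has_field_derivative_transform_within[OF
        has_field_derivative_at_within[OF p], of 1]) auto
  have outside: "(bump l j has_real_derivative bump l (Suc j) x) (at x within S)"
    if "S \<subseteq> {..0} \<union> {1..}" "x \<in> S" for x S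
  proof -
    have "bump l (Suc j) x = 0" using off' that by blast
    then show ?thesis
      using that off by (simp, intro has_field_derivative_transform_within[OF
        DERIV_const[of 0], of 1]) auto
  qed
  consider "t < 0" | "1 < t" | "0 < t" "t < 1" | "t = 0" | "t = 1" by linarith
  then show ?thesis
  proof cases
    case 1
    then have "(bump l j has_real_derivative bump l (Suc j) t) (at t within {..<0})"
      by (intro outside) auto
    then show ?thesis using 1 at_within_open[of t "{..<0}"] by simp
  next
    case 2
    then have "(bump l j has_real_derivative bump l (Suc j) t) (at t within {1<..})"
      by (intro outside) auto
    then show ?thesis using 2 at_within_open[of t "{1<..}"] by simp
  next
    case 3
    then have "(bump l j has_real_derivative bump l (Suc j) t) (at t within {0..1})"
      by (intro inside) auto
    then show ?thesis using 3 at_within_Icc_at[of 0 t 1] by simp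
  next
    case 4
    have "(bump l j has_real_derivative bump l (Suc j) t) (at t within {..0} \<union> {0..1})"
      using 4 by (intro has_field_derivative_within_Un inside outside) auto
    moreover have "at t within {..0} \<union> {0..1} = at t"
      using 4 by (intro at_within_interior) (auto intro!: interiorI[of "{-1<..<1}"])
    ultimately show ?thesis by simp
  next
    case 5
    have "(bump l j has_real_derivative bump l (Suc j) t) (at t within {0..1} \<union> {1..})"
      using 5 by (intro has_field_derivative_within_Un inside outside) auto
    moreover have "at t within {0..1} \<union> {1..} = at t"
      using 5 by (intro at_within_interior) (auto intro!: interiorI[of "{0<..<2}"])
    ultimately show ?thesis by simp
  qed
qed

text \<open>
  The \<open>l\<close>-th derivative is a polynomial composed with the projection onto the unit interval. The
  minimum with 1 makes the bound usable for every Hoelder exponent between 0 and 1.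
\<close>

lemma bump_lipschitz:
  "\<exists>B>0. \<forall>s t. \<bar>bump l l s - bump l l t\<bar> \<le> B * min 1 \<bar>s - t\<bar>"
proof -
  define p where "p = (pderiv ^^ l) (bump_poly l)"
  have "compact ((\<lambda>x. poly (pderiv p) x) ` {0..1::real})"
    by (intro compact_continuous_image continuous_intros) auto
  from compact_imp_bounded[OF this]
  obtain B1 where "\<forall>y\<in>(\<lambda>x. poly (pderiv p) x) ` {0..1}. \<bar>y\<bar> \<le> B1" unfolding bounded_real by blast
  then have B1: "\<And>x. x \<in> {0..1} \<Longrightarrow> \<bar>poly (pderiv p) x\<bar> \<le> B1" by blast
  define B where "B = max B1 1"
  have "B > 0" by (simp add: B_def)
  define c :: "real \<Rightarrow> real" where "c = (\<lambda>t. max 0 (min 1 t))"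
  have c: "c t \<in> {0..1}" for t by (auto simp: c_def)
  have cl: "\<bar>c s - c t\<bar> \<le> min 1 \<bar>s - t\<bar>" for s t by (auto simp: c_def)
  have bc: "bump l l t = poly p (c t)" for t
  proof (cases "t \<in> {0..1}")
    case True then show ?thesis by (auto simp: bump_def c_def p_def)
  next
    case False
    then have "bump l l t = 0" "c t = 0 \<or> c t = 1" by (auto simp: bump_def c_def)
    then show ?thesis using bump_poly_boundary[of l l "c t"] by (simp add: p_def)
  qed
  have lip: "\<bar>poly p u - poly p v\<bar> \<le> B * \<bar>u - v\<bar>" if "u \<in> {0..1}" "v \<in> {0..1}" for u v
  proof -
    have "norm (poly p u - poly p v) \<le> B * norm (u - v)"
      by (rule field_differentiable_bound[of "{0..1}" "poly p" "poly (pderiv p)"])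
        (use that B1 in \<open>auto intro!: has_field_derivative_at_within poly_DERIV simp: B_def
          intro: order_trans[OF B1]\<close>)
    then show ?thesis by simp
  qed
  have "\<bar>bump l l s - bump l l t\<bar> \<le> B * min 1 \<bar>s - t\<bar>" for s t
    unfolding bc using lip[OF c c, of s t] mult_left_mono[OF cl, of B s t] \<open>B > 0\<close> by linarith
  moreover note \<open>B > 0\<close>
  ultimately show ?thesis by blast
qed

lemma bump_measurable[measurable]: "bump l 0 \<in> borel_measurable borel"
  unfolding bump_0_eq[abs_def] by measurable

lemma bump_range: "0 \<le> bump l 0 t" "bump l 0 t \<le> 1"
  unfolding bump_0_eq by (auto intro!: power_le_one mult_le_one simp del: power_Suc)

lemma bump_middle: "(3 / 16) ^ Suc l \<le> bump l 0 t" if "t \<in> {1/4..3/4}"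
proof -
  have "0 \<le> (t - 1/4) * (3/4 - t)" using that by (intro mult_nonneg_nonneg) auto
  also have "(t - 1/4) * (3/4 - t) = t * (1 - t) - 3 / 16" by (simp add: field_simps)
  finally have "3 / 16 \<le> t * (1 - t)" by simp
  then have "(3 / 16) ^ Suc l \<le> (t * (1 - t)) ^ Suc l" by (intro power_mono) auto
  then show ?thesis using that by (simp add: bump_0_eq del: power_Suc)
qed

text \<open>
  A sum of bumps of width \<open>h\<close>, placed in those cells of a grid starting at \<open>a\<close> whose index
  belongs to \<open>S\<close>, with amplitude \<open>A\<close>. The index \<open>j\<close> again counts derivatives, whence the
  power of \<open>h\<close>.
\<close>

definition bump_train :: "nat \<Rightarrow> nat \<Rightarrow> real \<Rightarrow> real \<Rightarrow> real \<Rightarrow> nat set \<Rightarrow> real \<Rightarrow> real" where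
  "bump_train l j A a h S x = A / h ^ j * (\<Sum>k\<in>S. bump l j ((x - a) / h - real k))"

lemma bump_train_measurable[measurable]: "bump_train l 0 A a h S \<in> borel_measurable borel"
  unfolding bump_train_def[abs_def] by measurable

text \<open>
  Each point lies in the interior of the support of at most one translate, so the modulus of continuity
  of the sum is at most twice that of one bump, whatever the number of bumps.
\<close>

lemma sum_bump_lipschitz:
  fixes g :: "real \<Rightarrow> real"
  assumes S: "finite S" and g0: "\<And>t. t \<le> 0 \<or> 1 \<le> t \<Longrightarrow> g t = 0"
    and gl: "\<And>s t. \<bar>g s - g t\<bar> \<le> B * m (s - t)" and "0 \<le> B" "0 \<le> m (s - t)"
  shows "\<bar>(\<Sum>k\<in>S. g (s - real k)) - (\<Sum>k\<in>S. g (t - real k))\<bar> \<le> 2 * (B * m (s - t))"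
proof -
  define T where "T = {k \<in> S. real_of_int \<lfloor>s\<rfloor> = real k \<or> real_of_int \<lfloor>t\<rfloor> = real k}"
  have T: "T \<subseteq> {nat \<lfloor>s\<rfloor>, nat \<lfloor>t\<rfloor>}"
  proof
    fix k assume "k \<in> T"
    then have "\<lfloor>s\<rfloor> = int k \<or> \<lfloor>t\<rfloor> = int k" unfolding T_def by auto
    then show "k \<in> {nat \<lfloor>s\<rfloor>, nat \<lfloor>t\<rfloor>}" by auto
  qed
  have zero: "g (u - real k) = 0" if "real_of_int \<lfloor>u\<rfloor> \<noteq> real k" for u k
  proof (rule g0)
    have "\<lfloor>u\<rfloor> \<noteq> int k" using that by auto
    then have "\<lfloor>u\<rfloor> \<le> int k - 1 \<or> int k + 1 \<le> \<lfloor>u\<rfloor>" by linarith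
    then show "u - real k \<le> 0 \<or> 1 \<le> u - real k" by linarith
  qed
  have "(\<Sum>k\<in>S. g (s - real k)) - (\<Sum>k\<in>S. g (t - real k)) = (\<Sum>k\<in>S. g (s - real k) - g (t - real k))"
    by (simp add: sum_subtractf)
  also have "\<dots> = (\<Sum>k\<in>T. g (s - real k) - g (t - real k))"
    by (rule sum.mono_neutral_right) (use S zero in \<open>auto simp: T_def\<close>)
  finally have "\<bar>(\<Sum>k\<in>S. g (s - real k)) - (\<Sum>k\<in>S. g (t - real k))\<bar> \<le>
      (\<Sum>k\<in>T. \<bar>g (s - real k) - g (t - real k)\<bar>)" by simp
  also have "\<dots> \<le> (\<Sum>k\<in>T. B * m (s - t))"
  proof (rule sum_mono)
    fix k show "\<bar>g (s - real k) - g (t - real k)\<bar> \<le> B * m (s - t)"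
      using gl[of "s - real k" "t - real k"] by simp
  qed
  also have "\<dots> = real (card T) * (B * m (s - t))" by simp
  also have "\<dots> \<le> 2 * (B * m (s - t))"
  proof (rule mult_right_mono)
    have "card T \<le> card {nat \<lfloor>s\<rfloor>, nat \<lfloor>t\<rfloor>}" using T by (intro card_mono) auto
    also have "\<dots> \<le> 2" by (simp add: card_insert_if)
    finally show "real (card T) \<le> 2" by simp
  qed (use assms in simp)
  finally show ?thesis .
qed

lemma bump_train_has_derivative:
  assumes "j < l" "h > 0"
  shows "(bump_train l j A a h S has_real_derivative bump_train l (Suc j) A a h S x) (at x)"
proof -
  have "((\<lambda>x. A / h ^ j * (\<Sum>k\<in>S. bump l j ((x - a) / h - real k))) has_real_derivative
      A / h ^ j * (\<Sum>k\<in>S. bump l (Suc j) ((x - a) / h - real k) * (1 / h))) (at x)"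
  proof (intro DERIV_cmult DERIV_sum)
    fix k
    show "((\<lambda>x. bump l j ((x - a) / h - real k)) has_real_derivative
        bump l (Suc j) ((x - a) / h - real k) * (1 / h)) (at x)"
      by (rule DERIV_chain2[OF bump_has_derivative[OF assms(1)]])
        (use assms(2) in \<open>auto intro!: derivative_eq_intros\<close>)
  qed
  then show ?thesis
    unfolding bump_train_def[abs_def] by (simp add: sum_divide_distrib[symmetric] mult.commute)
qed

lemma bump_train_outside:
  assumes "j \<le> l" "h > 0" "S \<subseteq> {..<K}" "x \<le> a \<or> a + real K * h \<le> x"
  shows "bump_train l j A a h S x = 0"
proof -
  have "bump l j ((x - a) / h - real k) = 0" if "k \<in> S" for k
  proof (rule bump_eq_0[OF assms(1)])
    have k: "real k + 1 \<le> real K" using that assms(3) by auto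
    show "(x - a) / h - real k \<le> 0 \<or> 1 \<le> (x - a) / h - real k"
    proof (cases "x \<le> a")
      case True
      then have "(x - a) / h \<le> 0" using assms(2) by (simp add: divide_le_0_iff)
      then show ?thesis by simp
    next
      case False
      then have "real K \<le> (x - a) / h" using assms by (simp add: pos_le_divide_eq)
      then show ?thesis using k by simp
    qed
  qed
  then show ?thesis by (simp add: bump_train_def)
qed

text \<open>
  The amplitude \<open>A * h powr \<beta>\<close> compensates the scaling: the \<open>l\<close>-th derivative carries the factor
  \<open>h powr (\<beta> - l)\<close>, and \<open>min 1 u \<le> u powr (\<beta> - l)\<close> for \<open>u = \<bar>x - y\<bar> / h\<close> cancels it. Hence
  \<open>A\<close> depends on \<open>\<beta>\<close> and \<open>L\<close> only, not on the width or the number of bumps.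
\<close>

lemma bump_train_holder_zero:
  assumes "0 < \<beta>" "0 < L"
  shows "\<exists>A>0. \<forall>a h K S. 0 \<le> a \<and> 0 < h \<and> a + real K * h \<le> 1 \<and> S \<subseteq> {..<K} \<longrightarrow>
    bump_train (nat \<lfloor>\<beta>\<rfloor>) 0 (A * h powr \<beta>) a h S \<in> holder_zero \<beta> L"
proof -
  define l where "l = nat \<lfloor>\<beta>\<rfloor>"
  have l: "real l \<le> \<beta>" "\<beta> < real l + 1" using assms unfolding l_def by linarith+
  obtain B where B: "B > 0" "\<And>s t. \<bar>bump l l s - bump l l t\<bar> \<le> B * min 1 \<bar>s - t\<bar>"
    using bump_lipschitz by blast
  define A where "A = L / (2 * B)"
  have "bump_train l 0 (A * h powr \<beta>) a h S \<in> holder_zero \<beta> L"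
    if h: "0 \<le> a" "0 < h" "a + real K * h \<le> 1" "S \<subseteq> {..<K}" for a h K S
  proof -
    define D where "D j = bump_train l j (A * h powr \<beta>) a h S" for j
    have "\<bar>D l x - D l y\<bar> \<le> L * \<bar>x - y\<bar> powr (\<beta> - real l)" for x y
    proof (cases "x = y")
      case False
      define u where "u = \<bar>x - y\<bar> / h"
      have u: "u > 0" using False h by (simp add: u_def)
      have "min 1 u \<le> u powr (\<beta> - real l)"
      proof (cases "u \<le> 1")
        case True
        have "u powr 1 \<le> u powr (\<beta> - real l)" using True u l by (intro powr_mono') auto
        then show ?thesis using True u by simp
      next
        case False
        have "1 powr (\<beta> - real l) \<le> u powr (\<beta> - real l)" using False l by (intro powr_mono2) auto
        then show ?thesis using False by simp
      qed
      then have mu: "2 * (B * min 1 u) \<le> 2 * (B * u powr (\<beta> - real l))" using B(1) by simp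
      define s where "s = (x - a) / h"
      define t where "t = (y - a) / h"
      have st: "\<bar>s - t\<bar> = u" unfolding s_def t_def u_def using h
        by (simp add: diff_divide_distrib[symmetric])
      have "\<bar>(\<Sum>k\<in>S. bump l l (s - real k)) - (\<Sum>k\<in>S. bump l l (t - real k))\<bar> \<le> 2 * (B * min 1 \<bar>s - t\<bar>)"
        by (rule sum_bump_lipschitz[where m = "\<lambda>d. min 1 \<bar>d\<bar>"])
          (use B h finite_subset[OF h(4)] in \<open>auto intro: bump_eq_0\<close>)
      then have le: "\<bar>(\<Sum>k\<in>S. bump l l (s - real k)) - (\<Sum>k\<in>S. bump l l (t - real k))\<bar> \<le> 2 * (B * u powr (\<beta> - real l))"
        using mu st by simp
      have hl: "h powr \<beta> / h ^ l = h powr (\<beta> - real l)"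
        using h by (simp add: powr_diff powr_realpow)
      have "\<bar>D l x - D l y\<bar> = A * h powr (\<beta> - real l) * \<bar>(\<Sum>k\<in>S. bump l l (s - real k)) - (\<Sum>k\<in>S. bump l l (t - real k))\<bar>"
      proof -
        have "0 \<le> A * h powr (\<beta> - real l)" using assms B(1) by (simp add: A_def)
        moreover have "D l x - D l y = A * h powr (\<beta> - real l) *
            ((\<Sum>k\<in>S. bump l l (s - real k)) - (\<Sum>k\<in>S. bump l l (t - real k)))"
          unfolding D_def bump_train_def s_def t_def hl[symmetric] by (simp add: right_diff_distrib)
        ultimately show ?thesis by (simp only: abs_mult[of "A * h powr (\<beta> - real l)"] abs_of_nonneg)
      qed
      also have "\<dots> \<le> A * h powr (\<beta> - real l) * (2 * (B * u powr (\<beta> - real l)))"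
        using le assms B(1) by (intro mult_left_mono) (auto simp: A_def)
      also have "\<dots> = L * (h powr (\<beta> - real l) * u powr (\<beta> - real l))"
        using B(1) by (simp add: A_def)
      also have "h powr (\<beta> - real l) * u powr (\<beta> - real l) = \<bar>x - y\<bar> powr (\<beta> - real l)"
        using h by (simp add: u_def powr_divide)
      finally show ?thesis .
    qed simp
    moreover have "D j 0 = 0" "D j 1 = 0" if "j < l" for j
      unfolding D_def using bump_train_outside[OF _ h(2,4), of j l] that h by auto
    moreover have "(D j has_real_derivative D (Suc j) x) (at x within {0..1})" if "j < l" for j x
      unfolding D_def using bump_train_has_derivative[OF that h(2)]
      by (rule has_field_derivative_at_within)
    ultimately show ?thesis
      unfolding holder_zero_def Let_def l_def[symmetric]
      by (intro CollectI exI[of _ D]) (auto simp: D_def)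
  qed
  moreover have "A > 0" using assms B(1) by (simp add: A_def)
  ultimately show ?thesis unfolding l_def by blast
qed

lemma bump_train_diff:
  fixes k :: nat
  assumes "h > 0" "0 \<le> A" "finite S"
  defines "S' \<equiv> sym_diff S {k}"
  shows "\<bar>bump_train l 0 A a h S x - bump_train l 0 A a h S' x\<bar>
      = A * bump l 0 ((x - a) / h - real k)"
proof -
  have *: "(\<Sum>j\<in>S. f j) - (\<Sum>j\<in>S'. f j) = (if k \<in> S then f k else - f k)" for f :: "nat \<Rightarrow> real"
    using assms(3) by (auto simp: S'_def sum_diff1 insert_absorb)
  have "bump_train l 0 A a h S x - bump_train l 0 A a h S' x =
     A * ((\<Sum>j\<in>S. bump l 0 ((x - a) / h - real j)) - (\<Sum>j\<in>S'. bump l 0 ((x - a) / h - real j)))"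
    by (simp add: bump_train_def right_diff_distrib)
  then show ?thesis using assms(2) bump_range(1)[of l] by (auto simp: * abs_mult)
qed

section \<open>Assouad's lower bound\<close>

text \<open>
  Two kernels that differ by at most \<open>B\<close>, and only on \<open>\<Delta>\<close>, cannot be told apart reliably from \<open>M\<close>
  samples as long as \<open>M N B\<^sup>2 \<rho>(\<Delta>)\<close> stays bounded.
\<close>

lemma data_law_two_point:
  fixes X \<eta> :: "'a \<Rightarrow> nat \<Rightarrow> real ^ 'd" and p :: "(nat \<Rightarrow> real ^ 'd) \<Rightarrow> real"
  assumes model: "interaction_model P N X \<eta> p \<rho>'" and KL: "shift_KL_bound N p c" and "0 \<le> c" and N: "3 \<le> N"
    and \<phi>: "\<phi> \<in> borel_measurable borel" "\<phi>' \<in> borel_measurable borel"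
    and \<Delta>: "\<Delta> \<in> sets borel" and B: "\<And>r. \<bar>\<phi> r - \<phi>' r\<bar> \<le> B * indicator \<Delta> r" "0 \<le> B"
    and e: "real M * (c * (real N * B\<^sup>2 * measure (exploration P N X) \<Delta>)) \<le> e"
    and F: "F \<in> borel_measurable (Pi\<^sub>M {1..M} (\<lambda>_. config_space N \<Otimes>\<^sub>M config_space N))"
    and G: "G \<in> borel_measurable (Pi\<^sub>M {1..M} (\<lambda>_. config_space N \<Otimes>\<^sub>M config_space N))"
    and a: "0 \<le> a"
      "\<And>z. z \<in> space (Pi\<^sub>M {1..M} (\<lambda>_. config_space N \<Otimes>\<^sub>M config_space N)) \<Longrightarrow> ennreal a \<le> F z + G z"
  shows "ennreal (a * exp (- (e + 1))) \<le>
    (\<integral>\<^sup>+z. F z \<partial>data_law P N X \<eta> M \<phi>) + (\<integral>\<^sup>+z. G z \<partial>data_law P N X \<eta> M \<phi>')"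
proof -
  have P: "prob_space P" and indep: "prob_space.indep_var P (config_space N) X (config_space N) \<eta>"
    and p0: "\<And>u. u \<in> space (config_space N) \<Longrightarrow> 0 \<le> p u"
    and p: "distributed P (config_lborel N) \<eta> (\<lambda>u. ennreal (p u))"
    using model unfolding interaction_model_def by auto
  interpret prob_space P by fact
  have X[measurable]: "X \<in> measurable P (config_space N)" and \<eta>[measurable]: "\<eta> \<in> measurable P (config_space N)"
    using indep unfolding indep_var_distribution_eq by auto
  have ps: "prob_space (sample_law P N X \<eta> \<psi>)" if [measurable]: "\<psi> \<in> borel_measurable borel" for \<psi>
    unfolding sample_law_def observation_eq by (rule prob_space_distr) measurable
  have sl: "sets (sample_law P N X \<eta> \<psi>) = sets (config_space N \<Otimes>\<^sub>M config_space N)" for \<psi>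
    by (simp add: sample_law_def)
  have sd: "sets (data_law P N X \<eta> M \<psi>) = sets (Pi\<^sub>M {1..M} (\<lambda>_. config_space N \<Otimes>\<^sub>M config_space N))" for \<psi>
    unfolding data_law_def by (intro sets_PiM_cong sl refl)
  note V = interaction_diff_mean_sq[OF P X N \<Delta> B \<phi>]
  define \<kappa> where "\<kappa> = c * (\<integral>\<omega>. (\<Sum>i\<in>{1..N}. (norm (interaction N \<phi> (X \<omega>) i - interaction N \<phi>' (X \<omega>) i))\<^sup>2) \<partial>P)"
  have \<kappa>0: "0 \<le> \<kappa>"
    unfolding \<kappa>_def using \<open>0 \<le> c\<close> by (intro mult_nonneg_nonneg integral_nonneg_AE AE_I2 sum_nonneg) auto
  have "\<kappa> \<le> c * (real N * B\<^sup>2 * measure (exploration P N X) \<Delta>)"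
    unfolding \<kappa>_def using V(2) \<open>0 \<le> c\<close> by (rule mult_left_mono)
  then have "real M * \<kappa> \<le> real M * (c * (real N * B\<^sup>2 * measure (exploration P N X) \<Delta>))"
    by (rule mult_left_mono) simp
  then have Me: "real M * \<kappa> \<le> e" using e by linarith
  obtain w where "likelihood_ratio (sample_law P N X \<eta> \<phi>) (sample_law P N X \<eta> \<phi>') w \<kappa>"
    using likelihood_ratio_sample_law[OF P indep p0 p KL \<phi> V(1)] unfolding \<kappa>_def by blast
  from likelihood_ratio_PiM[OF ps[OF \<phi>(1)] ps[OF \<phi>(2)] _ this, of "{1..M}"]
  have w: "likelihood_ratio (data_law P N X \<eta> M \<phi>) (data_law P N X \<eta> M \<phi>') (\<lambda>z. \<Prod>i\<in>{1..M}. w (z i)) (real M * \<kappa>)"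
    by (simp add: data_law_def sl)
  have pd: "prob_space (data_law P N X \<eta> M \<psi>)" if "\<psi> \<in> borel_measurable borel" for \<psi>
    unfolding data_law_def by (intro prob_space_PiM ps that)
  have "a * exp (- (e + 1)) \<le> a * exp (- (real M * \<kappa> + 1))"
    using a(1) Me by (intro mult_left_mono) auto
  then have "ennreal (a * exp (- (e + 1))) \<le> ennreal (a * exp (- (real M * \<kappa> + 1)))" by (rule ennreal_leI)
  also have "\<dots> \<le> (\<integral>\<^sup>+z. F z \<partial>data_law P N X \<eta> M \<phi>) + (\<integral>\<^sup>+z. G z \<partial>data_law P N X \<eta> M \<phi>')"
  proof (rule likelihood_ratio_two_point[OF pd[OF \<phi>(1)] pd[OF \<phi>(2)] _ w])
    show "F \<in> borel_measurable (data_law P N X \<eta> M \<phi>)" "G \<in> borel_measurable (data_law P N X \<eta> M \<phi>)"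
      using F G by (simp_all add: measurable_cong_sets[OF sd refl])
    show "ennreal a \<le> F z + G z" if "z \<in> space (data_law P N X \<eta> M \<phi>)" for z
      using that by (intro a(2)) (simp add: sets_eq_imp_space_eq[OF sd])
  qed (use \<kappa>0 a(1) sd in auto)
  finally show ?thesis .
qed

text \<open>
  The largest of the risks indexed by the subsets \<open>S\<close> is at least their average. In the average, the
  \<open>k\<close>-th contributions of \<open>S\<close> and of \<open>S\<close> with the membership of \<open>k\<close> flipped can be paired, because
  flipping permutes the subsets.
\<close>

lemma assouad_average:
  fixes R :: "nat \<Rightarrow> nat set \<Rightarrow> ennreal"
  assumes pair: "\<And>S k. S \<subseteq> {..<K} \<Longrightarrow> k < K \<Longrightarrow> b \<le> R k S + R k (sym_diff S {k})"
    and total: "\<And>S. S \<subseteq> {..<K} \<Longrightarrow> (\<Sum>k<K. R k S) \<le> U"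
  shows "of_nat K * b \<le> 2 * U"
proof -
  have flip: "(\<Sum>S\<in>Pow {..<K}. R k (sym_diff S {k})) = (\<Sum>S\<in>Pow {..<K}. R k S)" if "k < K" for k
  proof (rule sum.reindex_bij_witness[where i = "\<lambda>S. sym_diff S {k}" and j = "\<lambda>S. sym_diff S {k}"])
  qed (use that in auto)
  have "(2::ennreal) ^ K * (of_nat K * b) = (\<Sum>S\<in>Pow {..<K}. \<Sum>k<K. b)"
    by (simp add: card_Pow)
  also have "\<dots> \<le> (\<Sum>S\<in>Pow {..<K}. \<Sum>k<K. R k S + R k (sym_diff S {k}))"
    by (intro sum_mono pair) auto
  also have "\<dots> = (\<Sum>S\<in>Pow {..<K}. \<Sum>k<K. R k S) + (\<Sum>k<K. \<Sum>S\<in>Pow {..<K}. R k (sym_diff S {k}))"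
    by (subst (2) sum.swap) (simp add: sum.distrib)
  also have "(\<Sum>k<K. \<Sum>S\<in>Pow {..<K}. R k (sym_diff S {k})) = (\<Sum>S\<in>Pow {..<K}. \<Sum>k<K. R k S)"
  proof -
    have "(\<Sum>k<K. \<Sum>S\<in>Pow {..<K}. R k (sym_diff S {k})) = (\<Sum>k<K. \<Sum>S\<in>Pow {..<K}. R k S)"
      by (intro sum.cong refl flip) auto
    then show ?thesis by (simp only: sum.swap[of _ "Pow {..<K}"])
  qed
  also have "(\<Sum>S\<in>Pow {..<K}. \<Sum>k<K. R k S) + (\<Sum>S\<in>Pow {..<K}. \<Sum>k<K. R k S)
      \<le> (\<Sum>S\<in>Pow {..<K}. U) + (\<Sum>S\<in>Pow {..<K}. U)"
    by (intro add_mono sum_mono total) auto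
  also have "\<dots> = 2 ^ K * (2 * U)"
    by (simp add: card_Pow mult_2[symmetric] mult.left_commute)
  finally show ?thesis
    by (subst (asm) ennreal_mult_le_mult_iff) (auto simp: power_eq_top_ennreal)
qed

text \<open>
  Measurability of an estimator concerns only arguments from the unit interval; composing with the
  projection onto that interval extends them without changing the loss on \<open>\<Delta>\<close>.
\<close>

lemma estimator_loss_measurable:
  assumes h: "h \<in> estimators N M" and [measurable]: "\<phi> \<in> borel_measurable borel" "\<Delta> \<in> sets borel"
    and \<Delta>: "\<Delta> \<subseteq> {0..1}"
  shows "(\<lambda>(z, r). ennreal ((h z r - \<phi> r)\<^sup>2) * indicator \<Delta> r)
    \<in> borel_measurable (Pi\<^sub>M {1..M} (\<lambda>_. config_space N \<Otimes>\<^sub>M config_space N) \<Otimes>\<^sub>M borel)"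
proof -
  let ?D = "Pi\<^sub>M {1..M} (\<lambda>_. config_space N \<Otimes>\<^sub>M config_space N)"
  define cl :: "real \<Rightarrow> real" where "cl r = max 0 (min 1 r)" for r
  have [measurable]: "cl \<in> measurable borel (restrict_space borel {0..1})"
    unfolding cl_def[abs_def] by (rule measurable_restrict_space2) auto
  have h': "(\<lambda>(z, r). h z r) \<in> borel_measurable (?D \<Otimes>\<^sub>M restrict_space borel {0..1})"
    using h by (simp add: estimators_def)
  have "(\<lambda>(z, r). (z, cl r)) \<in> measurable (?D \<Otimes>\<^sub>M borel) (?D \<Otimes>\<^sub>M restrict_space borel {0..1})"
    by measurable
  from measurable_compose[OF this h']
  have [measurable]: "(\<lambda>(z, r). h z (cl r)) \<in> borel_measurable (?D \<Otimes>\<^sub>M borel)"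
    by (simp add: split_beta')
  have "(\<lambda>(z, r). ennreal ((h z (cl r) - \<phi> r)\<^sup>2) * indicator \<Delta> r) \<in> borel_measurable (?D \<Otimes>\<^sub>M borel)"
    by measurable
  also have "(\<lambda>(z, r). ennreal ((h z (cl r) - \<phi> r)\<^sup>2) * indicator \<Delta> r) =
      (\<lambda>(z, r). ennreal ((h z r - \<phi> r)\<^sup>2) * indicator \<Delta> r)"
    using \<Delta> by (auto simp: fun_eq_iff indicator_def cl_def subset_eq split_beta')
  finally show ?thesis .
qed

lemma sum_sq_ge_half_diff_sq: "(x - y)\<^sup>2 / 2 \<le> (t - x)\<^sup>2 + (t - y)\<^sup>2" for x y t :: real
proof -
  have "0 \<le> (2 * t - x - y)\<^sup>2 / 2" by simp
  also have "\<dots> = (t - x)\<^sup>2 + (t - y)\<^sup>2 - (x - y)\<^sup>2 / 2"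
    by (simp add: power2_eq_square field_simps)
  finally show ?thesis by simp
qed

text \<open>
  No single estimate can be closer than half the squared distance, in total, to both kernels; the
  two-point bound then applies to the losses restricted to \<open>\<Delta>\<close>.
\<close>

lemma cell_loss_two_point:
  fixes X \<eta> :: "'a \<Rightarrow> nat \<Rightarrow> real ^ 'd" and p :: "(nat \<Rightarrow> real ^ 'd) \<Rightarrow> real"
  assumes model: "interaction_model P N X \<eta> p \<rho>'" and KL: "shift_KL_bound N p c" "0 \<le> c" and N: "3 \<le> N"
    and \<phi>[measurable]: "\<phi> \<in> borel_measurable borel" "\<phi>' \<in> borel_measurable borel"
    and \<Delta>[measurable]: "\<Delta> \<in> sets borel" and \<Delta>01: "\<Delta> \<subseteq> {0..1}"
    and B: "\<And>r. \<bar>\<phi> r - \<phi>' r\<bar> \<le> B * indicator \<Delta> r" "0 \<le> B"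
    and e: "real M * (c * (real N * B\<^sup>2 * measure (exploration P N X) \<Delta>)) \<le> e"
    and h: "h \<in> estimators N M" and a: "0 \<le> a"
      "ennreal a \<le> (\<integral>\<^sup>+r\<in>\<Delta>. ennreal ((\<phi> r - \<phi>' r)\<^sup>2 / 2) \<partial>exploration P N X)"
  shows "ennreal (a * exp (- (e + 1))) \<le>
    (\<integral>\<^sup>+z. (\<integral>\<^sup>+r\<in>\<Delta>. ennreal ((h z r - \<phi> r)\<^sup>2) \<partial>exploration P N X) \<partial>data_law P N X \<eta> M \<phi>) +
    (\<integral>\<^sup>+z. (\<integral>\<^sup>+r\<in>\<Delta>. ennreal ((h z r - \<phi>' r)\<^sup>2) \<partial>exploration P N X) \<partial>data_law P N X \<eta> M \<phi>')"
proof -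
  let ?D = "Pi\<^sub>M {1..M} (\<lambda>_. config_space N \<Otimes>\<^sub>M config_space N) :: (nat \<Rightarrow> (nat \<Rightarrow> real ^ 'd) \<times> (nat \<Rightarrow> real ^ 'd)) measure"
  define \<rho> where "\<rho> = exploration P N X"
  have \<rho>: "\<rho> = density lborel (\<lambda>r. ennreal (indicator {0..} r * \<rho>' r))"
    using model unfolding interaction_model_def \<rho>_def by auto
  have [measurable_cong]: "sets \<rho> = sets borel" by (simp add: \<rho>)
  interpret \<rho>: finite_measure \<rho>
    unfolding \<rho>_def by (rule finite_measure_exploration[OF model N])
  note hm = estimator_loss_measurable[OF h _ \<Delta> \<Delta>01]
  have m: "(\<lambda>z. \<integral>\<^sup>+r\<in>\<Delta>. ennreal ((h z r - \<psi> r)\<^sup>2) \<partial>\<rho>) \<in> borel_measurable ?D"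
    if "\<psi> \<in> borel_measurable borel" for \<psi>
    using hm[OF that] by measurable
  show ?thesis
  proof (rule data_law_two_point[OF model KL N \<phi> \<Delta> B e m[OF \<phi>(1), unfolded \<rho>_def] m[OF \<phi>(2), unfolded \<rho>_def] a(1)])
    fix z assume z: "z \<in> space ?D"
    have s: "(\<lambda>r. ennreal ((h z r - \<psi> r)\<^sup>2) * indicator \<Delta> r) \<in> borel_measurable \<rho>"
      if "\<psi> \<in> borel_measurable borel" for \<psi>
      using measurable_Pair2[OF hm[OF that] z] by (simp add: measurable_cong_sets[OF \<open>sets \<rho> = sets borel\<close> refl])
    have "ennreal a \<le> (\<integral>\<^sup>+r. ennreal ((\<phi> r - \<phi>' r)\<^sup>2 / 2) * indicator \<Delta> r \<partial>\<rho>)"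
      using a(2) by (simp add: \<rho>_def)
    also have "\<dots> \<le> (\<integral>\<^sup>+r. ennreal ((h z r - \<phi> r)\<^sup>2) * indicator \<Delta> r + ennreal ((h z r - \<phi>' r)\<^sup>2) * indicator \<Delta> r \<partial>\<rho>)"
    proof (rule nn_integral_mono)
      fix r
      have "ennreal ((\<phi> r - \<phi>' r)\<^sup>2 / 2) \<le> ennreal ((h z r - \<phi> r)\<^sup>2) + ennreal ((h z r - \<phi>' r)\<^sup>2)"
        using ennreal_leI[OF sum_sq_ge_half_diff_sq[of "\<phi> r" "\<phi>' r" "h z r"]] by (simp only: ennreal_plus zero_le_power2)
      then show "ennreal ((\<phi> r - \<phi>' r)\<^sup>2 / 2) * indicator \<Delta> r
          \<le> ennreal ((h z r - \<phi> r)\<^sup>2) * indicator \<Delta> r + ennreal ((h z r - \<phi>' r)\<^sup>2) * indicator \<Delta> r"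
        by (simp add: indicator_def)
    qed
    also have "\<dots> = (\<integral>\<^sup>+r\<in>\<Delta>. ennreal ((h z r - \<phi> r)\<^sup>2) \<partial>\<rho>) + (\<integral>\<^sup>+r\<in>\<Delta>. ennreal ((h z r - \<phi>' r)\<^sup>2) \<partial>\<rho>)"
      by (rule nn_integral_add[OF s[OF \<phi>(1)] s[OF \<phi>(2)]])
    finally show "ennreal a \<le> (\<integral>\<^sup>+r\<in>\<Delta>. ennreal ((h z r - \<phi> r)\<^sup>2) \<partial>exploration P N X)
        + (\<integral>\<^sup>+r\<in>\<Delta>. ennreal ((h z r - \<phi>' r)\<^sup>2) \<partial>exploration P N X)" by (simp add: \<rho>_def)
  qed
qed

lemma emeasure_radial_density_bounds:
  assumes \<rho>: "\<rho> = density lborel (\<lambda>r. ennreal (indicator {0..} r * \<rho>' r))"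
    and cont: "continuous_on {0..} \<rho>'" and s: "0 \<le> s" "s \<le> t"
    and bnd: "\<And>r. r \<in> {s..t} \<Longrightarrow> c \<le> \<rho>' r \<and> \<rho>' r \<le> C" "0 \<le> c"
  shows "ennreal (c * (t - s)) \<le> emeasure \<rho> {s..t}" "emeasure \<rho> {s..<t} \<le> ennreal (C * (t - s))"
proof -
  have [measurable]: "(\<lambda>r. indicator {0..} r * \<rho>' r) \<in> borel_measurable borel"
    using borel_measurable_continuous_on_indicator[OF _ cont] by simp
  have C0: "0 \<le> C" using bnd(1)[of s] bnd(2) s by auto
  have "ennreal (c * (t - s)) = (\<integral>\<^sup>+r. ennreal c * indicator {s..t} r \<partial>lborel)"
    using s bnd(2) by (simp add: nn_integral_cmult_indicator ennreal_mult')
  also have "\<dots> \<le> (\<integral>\<^sup>+r. ennreal (indicator {0..} r * \<rho>' r) * indicator {s..t} r \<partial>lborel)"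
    using s bnd by (intro nn_integral_mono) (auto simp: indicator_def intro!: ennreal_leI)
  also have "\<dots> = emeasure \<rho> {s..t}" unfolding \<rho> by (subst emeasure_density) auto
  finally show "ennreal (c * (t - s)) \<le> emeasure \<rho> {s..t}" .
  have "emeasure \<rho> {s..<t} = (\<integral>\<^sup>+r. ennreal (indicator {0..} r * \<rho>' r) * indicator {s..<t} r \<partial>lborel)"
    unfolding \<rho> by (subst emeasure_density) auto
  also have "\<dots> \<le> (\<integral>\<^sup>+r. ennreal C * indicator {s..<t} r \<partial>lborel)"
    using s bnd by (intro nn_integral_mono) (auto simp: indicator_def intro!: ennreal_leI)
  also have "\<dots> = ennreal (C * (t - s))"
    using s C0 by (simp add: nn_integral_cmult_indicator ennreal_mult')
  finally show "emeasure \<rho> {s..<t} \<le> ennreal (C * (t - s))" .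
qed

text \<open>
  The number \<open>K\<close> of cells is the smallest for which the cell width \<open>\<delta>\<close> satisfies
  \<open>M N \<delta> powr (2 \<beta> + 1) \<le> 1\<close>, so that the divergence between neighbouring hypotheses is at most
  \<open>c A\<^sup>2 C1\<close>. Rounding \<open>K\<close> up costs the factor \<open>w / (w + 1)\<close>. Each of the \<open>K\<close> cells contributes a loss
  proportional to \<open>\<delta> powr (2 \<beta> + 1)\<close>, and \<open>K \<delta> = w\<close>.
\<close>

lemma minimax_lower_bound:
  fixes X \<eta> :: "'a \<Rightarrow> nat \<Rightarrow> real ^ 'd" and p :: "(nat \<Rightarrow> real ^ 'd) \<Rightarrow> real"
  assumes model: "interaction_model P N X \<eta> p \<rho>'" and KL: "shift_KL_bound N p c" "0 \<le> c"
    and N: "3 \<le> N" and M: "1 \<le> M" and \<beta>: "0 < \<beta>"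
    and cont: "continuous_on {0..} \<rho>'"
    and w: "0 \<le> a" "0 < w" "a + w \<le> 1"
    and bnd: "\<And>r. r \<in> {a..a + w} \<Longrightarrow> c1 \<le> \<rho>' r \<and> \<rho>' r \<le> C1" "0 < c1"
    and A: "0 < A" "\<And>\<delta> K S. 0 < \<delta> \<Longrightarrow> a + real K * \<delta> \<le> 1 \<Longrightarrow> S \<subseteq> {..<K} \<Longrightarrow>
      bump_train l 0 (A * \<delta> powr \<beta>) a \<delta> S \<in> holder_zero \<beta> L"
    and h: "h \<in> estimators N M"
  defines "\<gamma> \<equiv> 2 * \<beta> / (2 * \<beta> + 1)" and "g \<equiv> (3 / 16 :: real) ^ Suc l"
  shows "ennreal (w * (w / (w + 1)) powr (2 * \<beta>) * A\<^sup>2 * g\<^sup>2 * c1 / 8 * exp (- (c * A\<^sup>2 * C1 + 1)) * real N powr - \<gamma>)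
    \<le> (SUP \<phi>\<in>holder_zero \<beta> L. scaled_risk P N X \<eta> \<beta> M h \<phi>)"
proof -
  define \<rho> where "\<rho> = exploration P N X"
  have \<rho>: "\<rho> = density lborel (\<lambda>r. ennreal (indicator {0..} r * \<rho>' r))"
    using model unfolding interaction_model_def \<rho>_def by auto
  define q where "q = (real M * real N) powr (1 / (2 * \<beta> + 1))"
  define K where "K = nat \<lceil>w * q\<rceil>"
  define \<delta> where "\<delta> = w / real K"
  have MN: "1 \<le> real M * real N" using M N mult_mono[of 1 "real M" 1 "real N"] by simp
  have q1: "1 \<le> q" unfolding q_def using MN \<beta> by (intro ge_one_powr_ge_zero) auto
  have wq: "0 < w * q" using w q1 by simp
  have K: "w * q \<le> real K" "real K < w * q + 1" unfolding K_def using wq by linarith+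
  have K0: "0 < real K" using K(1) wq by linarith
  have \<delta>0: "0 < \<delta>" and K\<delta>: "real K * \<delta> = w" using K0 w by (simp_all add: \<delta>_def)
  have \<delta>q: "\<delta> * q \<le> 1" using K(1) K0 by (simp add: \<delta>_def)
  have \<delta>_ge: "w / (w + 1) \<le> \<delta> * q"
  proof -
    have "real K \<le> (w + 1) * q" using K(2) q1 by (simp add: distrib_right)
    then have "w * real K \<le> w * ((w + 1) * q)" using w by (intro mult_left_mono) auto
    then show ?thesis using K0 w by (simp add: \<delta>_def field_simps)
  qed
  have budget: "real M * real N * \<delta> powr (2 * \<beta> + 1) \<le> 1"
  proof -
    have "(\<delta> * q) powr (2 * \<beta> + 1) \<le> 1 powr (2 * \<beta> + 1)"
      using \<delta>q \<delta>0 q1 \<beta> by (intro powr_mono2) auto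
    moreover have "q powr (2 * \<beta> + 1) = real M * real N"
      unfolding q_def using \<beta> MN by (simp add: powr_powr)
    ultimately show ?thesis using \<delta>0 q1 by (simp add: powr_mult mult.commute)
  qed
  have \<delta>\<gamma>: "(w / (w + 1)) powr (2 * \<beta>) * real N powr - \<gamma> \<le> real M powr \<gamma> * \<delta> powr (2 * \<beta>)"
  proof -
    have q2: "q powr (2 * \<beta>) = real M powr \<gamma> * real N powr \<gamma>"
      unfolding q_def \<gamma>_def using M N \<beta> by (simp add: powr_powr powr_mult)
    have "(w / (w + 1)) powr (2 * \<beta>) \<le> (\<delta> * q) powr (2 * \<beta>)"
      using \<delta>_ge w \<beta> by (intro powr_mono2) auto
    also have "\<dots> = \<delta> powr (2 * \<beta>) * (real M powr \<gamma> * real N powr \<gamma>)"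
      using \<delta>0 q1 by (simp add: powr_mult q2)
    finally have "(w / (w + 1)) powr (2 * \<beta>) * real N powr - \<gamma> \<le>
        \<delta> powr (2 * \<beta>) * (real M powr \<gamma> * real N powr \<gamma>) * real N powr - \<gamma>"
      by (rule mult_right_mono) simp
    also have "\<dots> = real M powr \<gamma> * \<delta> powr (2 * \<beta>)"
      using N by (simp add: powr_minus)
    finally show ?thesis .
  qed
  define B where "B = A * \<delta> powr \<beta>"
  have B0: "0 \<le> B" using A(1) by (simp add: B_def)
  have B2: "B\<^sup>2 = A\<^sup>2 * \<delta> powr (2 * \<beta>)"
    using \<delta>0 by (simp add: B_def power_mult_distrib powr_power mult.commute)
  define \<phi> where "\<phi> = bump_train l 0 B a \<delta>"
  have \<phi>m[measurable]: "\<phi> S \<in> borel_measurable borel" for S unfolding \<phi>_def by measurable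
  have \<phi>H: "\<phi> S \<in> holder_zero \<beta> L" if "S \<subseteq> {..<K}" for S
    unfolding \<phi>_def B_def using A(2)[OF \<delta>0 _ that] K\<delta> w by simp
  define \<Delta> where "\<Delta> k = {a + real k * \<delta>..<a + real (Suc k) * \<delta>}" for k
  define E where "E = c * A\<^sup>2 * C1"
  \<comment> \<open>A lower bound for half the squared distance on a cell, from its middle half alone.\<close>
  define sep where "sep = (B * g)\<^sup>2 / 2 * (c1 * (\<delta> / 2))"
  have sep0: "0 \<le> sep" using bnd(2) \<delta>0 by (simp add: sep_def)
  define s where "s = real M powr \<gamma>"
  define R where "R k S = (\<integral>\<^sup>+z. (\<integral>\<^sup>+r\<in>\<Delta> k. ennreal ((h z r - \<phi> S r)\<^sup>2) \<partial>\<rho>) \<partial>data_law P N X \<eta> M (\<phi> S))" for k S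
  have cell: "a + real k * \<delta> \<ge> a" "a + real (Suc k) * \<delta> \<le> a + w" if "k < K" for k
  proof -
    have "real (Suc k) \<le> real K" using that by simp
    then have "real (Suc k) * \<delta> \<le> real K * \<delta>" using \<delta>0 by (intro mult_right_mono) auto
    then show "a + real (Suc k) * \<delta> \<le> a + w" by (simp only: K\<delta>)
    show "a + real k * \<delta> \<ge> a" using \<delta>0 by simp
  qed
  have cell01: "\<Delta> k \<subseteq> {0..1}" if "k < K" for k
    using cell[OF that] w by (auto simp: \<Delta>_def)
  \<comment> \<open>Flipping the \<open>k\<close>-th bump changes the kernel on the \<open>k\<close>-th cell only.\<close>
  have pair: "ennreal (sep * exp (- (E + 1))) \<le> R k S + R k (sym_diff S {k})"
    if S: "S \<subseteq> {..<K}" and k: "k < K" for S k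
    unfolding R_def \<rho>_def
  proof (rule cell_loss_two_point[OF model KL N \<phi>m \<phi>m _ cell01[OF k] _ B0 _ h sep0])
    have fin: "finite S" using S finite_subset by blast
    have diff: "\<bar>\<phi> S r - \<phi> (sym_diff S {k}) r\<bar> = B * bump l 0 ((r - a) / \<delta> - real k)" for r
      unfolding \<phi>_def by (rule bump_train_diff[OF \<delta>0 B0 fin])
    show "\<Delta> k \<in> sets borel" by (simp add: \<Delta>_def)
    show "\<bar>\<phi> S r - \<phi> (sym_diff S {k}) r\<bar> \<le> B * indicator (\<Delta> k) r" for r
    proof (cases "r \<in> \<Delta> k")
      case True
      then show ?thesis unfolding diff using bump_range(2)[of l] B0 by (simp add: mult_left_le)
    next
      case False
      then have "(r - a) / \<delta> - real k \<le> 0 \<or> 1 \<le> (r - a) / \<delta> - real k"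
        using \<delta>0 by (auto simp: \<Delta>_def field_simps)
      then show ?thesis unfolding diff using bump_eq_0[of 0 l] False by simp
    qed
    show "real M * (c * (real N * B\<^sup>2 * measure (exploration P N X) (\<Delta> k))) \<le> E"
    proof -
      have C1: "0 \<le> C1" using bnd(1)[of a] bnd(2) w by auto
      have "emeasure \<rho> (\<Delta> k) \<le> ennreal (C1 * (a + real (Suc k) * \<delta> - (a + real k * \<delta>)))"
        unfolding \<Delta>_def
      proof (rule emeasure_radial_density_bounds(2)[OF \<rho> cont, of _ _ c1])
        show "0 \<le> a + real k * \<delta>" using cell(1)[OF k] w by linarith
        show "a + real k * \<delta> \<le> a + real (Suc k) * \<delta>" using \<delta>0 by (simp add: mult_right_mono)
        show "c1 \<le> \<rho>' r \<and> \<rho>' r \<le> C1" if "r \<in> {a + real k * \<delta>..a + real (Suc k) * \<delta>}" for r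
          using that cell[OF k] by (intro bnd(1)) (simp only: atLeastAtMost_iff, linarith)
      qed (use bnd(2) in simp)
      also have "C1 * (a + real (Suc k) * \<delta> - (a + real k * \<delta>)) = C1 * \<delta>"
        by (simp add: algebra_simps)
      finally have "measure \<rho> (\<Delta> k) \<le> C1 * \<delta>"
        using C1 \<delta>0 by (simp add: measure_def enn2real_leI)
      then have "real M * (c * (real N * B\<^sup>2 * measure \<rho> (\<Delta> k))) \<le> real M * (c * (real N * B\<^sup>2 * (C1 * \<delta>)))"
        using KL(2) by (intro mult_left_mono) auto
      also have "\<dots> = E * (real M * real N * (\<delta> powr (2 * \<beta>) * \<delta>))"
        by (simp add: B2 E_def)
      also have "\<delta> powr (2 * \<beta>) * \<delta> = \<delta> powr (2 * \<beta> + 1)"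
        using \<delta>0 by (simp add: powr_add)
      also have "E * (real M * real N * \<delta> powr (2 * \<beta> + 1)) \<le> E * 1"
        using budget C1 KL(2) by (intro mult_left_mono) (auto simp: E_def)
      finally show ?thesis by (simp add: \<rho>_def)
    qed
    show "ennreal sep \<le> (\<integral>\<^sup>+r\<in>\<Delta> k. ennreal ((\<phi> S r - \<phi> (sym_diff S {k}) r)\<^sup>2 / 2) \<partial>exploration P N X)"
    proof -
      define lo where "lo = a + (real k + 1 / 4) * \<delta>"
      define hi where "hi = a + (real k + 3 / 4) * \<delta>"
      have lohi: "hi - lo = \<delta> / 2" by (simp add: lo_def hi_def algebra_simps)
      have sub: "{lo..hi} \<subseteq> \<Delta> k" using \<delta>0 by (auto simp: lo_def hi_def \<Delta>_def algebra_simps)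
      have in_w: "r \<in> {a..a + w}" if "r \<in> {lo..hi}" for r
        using sub cell[OF k] that by (fastforce simp: \<Delta>_def)
      have "ennreal (c1 * (hi - lo)) \<le> emeasure \<rho> {lo..hi}"
      proof (rule emeasure_radial_density_bounds(1)[OF \<rho> cont, of _ _ _ C1])
        show "0 \<le> lo" unfolding lo_def using \<delta>0 w by (intro add_nonneg_nonneg mult_nonneg_nonneg) auto
        show "lo \<le> hi" using lohi \<delta>0 by linarith
      qed (use bnd in_w in auto)
      then have "ennreal ((B * g)\<^sup>2 / 2) * ennreal (c1 * (\<delta> / 2)) \<le> ennreal ((B * g)\<^sup>2 / 2) * emeasure \<rho> {lo..hi}"
        unfolding lohi by (rule mult_left_mono) simp
      then have "ennreal sep \<le> ennreal ((B * g)\<^sup>2 / 2) * emeasure \<rho> {lo..hi}"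
        unfolding sep_def using bnd(2) \<delta>0 by (subst ennreal_mult) auto
      also have "\<dots> = (\<integral>\<^sup>+r. ennreal ((B * g)\<^sup>2 / 2) * indicator {lo..hi} r \<partial>\<rho>)"
        by (subst nn_integral_cmult_indicator) (auto simp: \<rho>)
      also have "\<dots> \<le> (\<integral>\<^sup>+r\<in>\<Delta> k. ennreal ((\<phi> S r - \<phi> (sym_diff S {k}) r)\<^sup>2 / 2) \<partial>\<rho>)"
      proof (rule nn_integral_mono)
        fix r
        show "ennreal ((B * g)\<^sup>2 / 2) * indicator {lo..hi} r \<le>
            ennreal ((\<phi> S r - \<phi> (sym_diff S {k}) r)\<^sup>2 / 2) * indicator (\<Delta> k) r"
        proof (cases "r \<in> {lo..hi}")
          case True
          then have "(r - a) / \<delta> - real k \<in> {1/4..3/4}"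
            using \<delta>0 by (auto simp: lo_def hi_def field_simps)
          from bump_middle[OF this, of l] have "B * g \<le> \<bar>\<phi> S r - \<phi> (sym_diff S {k}) r\<bar>"
            unfolding diff g_def using B0 by (rule mult_left_mono)
          moreover have "0 \<le> B * g" using B0 by (simp add: g_def)
          ultimately have "(B * g)\<^sup>2 \<le> \<bar>\<phi> S r - \<phi> (sym_diff S {k}) r\<bar>\<^sup>2" by (rule power_mono)
          then have "ennreal ((B * g)\<^sup>2 / 2) \<le> ennreal ((\<phi> S r - \<phi> (sym_diff S {k}) r)\<^sup>2 / 2)"
            by (intro ennreal_leI) simp
          then show ?thesis using True sub by auto
        qed simp
      qed
      finally show ?thesis by (simp add: \<rho>_def)
    qed
  qed
  define U where "U = (SUP \<phi>\<in>holder_zero \<beta> L. scaled_risk P N X \<eta> \<beta> M h \<phi>)"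
  let ?D = "Pi\<^sub>M {1..M} (\<lambda>_. config_space N \<Otimes>\<^sub>M config_space N) :: (nat \<Rightarrow> (nat \<Rightarrow> real ^ 'd) \<times> (nat \<Rightarrow> real ^ 'd)) measure"
  have sd: "sets (data_law P N X \<eta> M \<psi>) = sets ?D" for \<psi>
    unfolding data_law_def by (intro sets_PiM_cong) (auto simp: sample_law_def)
  interpret \<rho>: finite_measure \<rho>
    unfolding \<rho>_def by (rule finite_measure_exploration[OF model N])
  have s\<rho>: "sets \<rho> = sets borel" by (simp add: \<rho>)
  have total: "(\<Sum>k<K. ennreal s * R k S) \<le> U" if S: "S \<subseteq> {..<K}" for S
  proof -
    have hm: "(\<lambda>(z, r). ennreal ((h z r - \<phi> S r)\<^sup>2) * indicator (\<Delta> k) r) \<in> borel_measurable (?D \<Otimes>\<^sub>M borel)"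
      if "k < K" for k
      by (rule estimator_loss_measurable[OF h \<phi>m _ cell01[OF that]]) (simp add: \<Delta>_def)
    have cong1: "measurable (data_law P N X \<eta> M (\<phi> S) \<Otimes>\<^sub>M \<rho>) borel = measurable (?D \<Otimes>\<^sub>M borel) borel"
      by (intro measurable_cong_sets sets_pair_measure_cong sd s\<rho> refl)
    have m1: "(\<lambda>z. \<integral>\<^sup>+r\<in>\<Delta> k. ennreal ((h z r - \<phi> S r)\<^sup>2) \<partial>\<rho>) \<in> borel_measurable (data_law P N X \<eta> M (\<phi> S))"
      if "k < K" for k
      by (rule \<rho>.borel_measurable_nn_integral) (use hm[OF that] in \<open>simp add: cong1\<close>)
    have m2: "(\<lambda>r. ennreal ((h z r - \<phi> S r)\<^sup>2) * indicator (\<Delta> k) r) \<in> borel_measurable \<rho>"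
      if "k < K" "z \<in> space (data_law P N X \<eta> M (\<phi> S))" for k z
      using measurable_Pair2[OF hm[OF that(1)], of z] that(2)
      by (simp add: measurable_cong_sets[OF s\<rho> refl] sets_eq_imp_space_eq[OF sd])
    have ind: "(\<Sum>k<K. indicator (\<Delta> k) r) \<le> (indicator {0..1} r :: ennreal)" for r
    proof -
      have "disjoint_family_on \<Delta> {..<K}"
        unfolding disjoint_family_on_def
      proof (intro ballI impI)
        fix i j :: nat assume "i \<noteq> j"
        then have "real (Suc i) \<le> real j \<or> real (Suc j) \<le> real i" by linarith
        then have "real (Suc i) * \<delta> \<le> real j * \<delta> \<or> real (Suc j) * \<delta> \<le> real i * \<delta>"
          using \<delta>0 by (meson mult_right_mono less_imp_le)
        then show "\<Delta> i \<inter> \<Delta> j = {}" by (auto simp: \<Delta>_def)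
      qed
      then have "(\<Sum>k<K. indicator (\<Delta> k) r) = (indicator (\<Union>k<K. \<Delta> k) r :: ennreal)"
        by (intro indicator_UN_disjoint[symmetric]) auto
      also have "\<dots> \<le> indicator {0..1} r"
      proof -
        have "(\<Union>k<K. \<Delta> k) \<subseteq> {0..1}" using cell01 by blast
        then show ?thesis by (auto simp: indicator_def subset_eq)
      qed
      finally show ?thesis .
    qed
    have "(\<Sum>k<K. ennreal s * R k S) =
        (\<integral>\<^sup>+z. (\<Sum>k<K. ennreal s * (\<integral>\<^sup>+r\<in>\<Delta> k. ennreal ((h z r - \<phi> S r)\<^sup>2) \<partial>\<rho>)) \<partial>data_law P N X \<eta> M (\<phi> S))"
      unfolding R_def using m1 by (subst nn_integral_sum) (auto simp: nn_integral_cmult)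
    also have "\<dots> \<le> (\<integral>\<^sup>+z. ennreal s * L2_norm_sq \<rho> (\<lambda>r. h z r - \<phi> S r) \<partial>data_law P N X \<eta> M (\<phi> S))"
    proof (rule nn_integral_mono)
      fix z assume z: "z \<in> space (data_law P N X \<eta> M (\<phi> S))"
      have "(\<Sum>k<K. ennreal s * (\<integral>\<^sup>+r\<in>\<Delta> k. ennreal ((h z r - \<phi> S r)\<^sup>2) \<partial>\<rho>)) =
          ennreal s * (\<Sum>k<K. \<integral>\<^sup>+r\<in>\<Delta> k. ennreal ((h z r - \<phi> S r)\<^sup>2) \<partial>\<rho>)"
        by (simp add: sum_distrib_left)
      also have "(\<Sum>k<K. \<integral>\<^sup>+r\<in>\<Delta> k. ennreal ((h z r - \<phi> S r)\<^sup>2) \<partial>\<rho>) =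
          (\<integral>\<^sup>+r. (\<Sum>k<K. ennreal ((h z r - \<phi> S r)\<^sup>2) * indicator (\<Delta> k) r) \<partial>\<rho>)"
        by (rule nn_integral_sum[symmetric]) (use m2 z in auto)
      also have "\<dots> \<le> (\<integral>\<^sup>+r. ennreal ((h z r - \<phi> S r)\<^sup>2) * indicator {0..1} r \<partial>\<rho>)"
        unfolding sum_distrib_left[symmetric] by (intro nn_integral_mono mult_left_mono ind) simp
      finally show "(\<Sum>k<K. ennreal s * (\<integral>\<^sup>+r\<in>\<Delta> k. ennreal ((h z r - \<phi> S r)\<^sup>2) \<partial>\<rho>)) \<le>
          ennreal s * L2_norm_sq \<rho> (\<lambda>r. h z r - \<phi> S r)"
        unfolding L2_norm_sq_def by (simp add: mult_left_mono)
    qed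
    also have "\<dots> = scaled_risk P N X \<eta> \<beta> M h (\<phi> S)"
      by (simp add: scaled_risk_def s_def \<gamma>_def \<rho>_def)
    also have "\<dots> \<le> U" unfolding U_def by (rule SUP_upper[OF \<phi>H[OF S]])
    finally show ?thesis .
  qed
  have "of_nat K * (ennreal s * ennreal (sep * exp (- (E + 1)))) \<le> 2 * U"
  proof (rule assouad_average[OF _ total])
    fix S k assume "S \<subseteq> {..<K}" "k < K"
    from mult_left_mono[OF pair[OF this], of "ennreal s"]
    show "ennreal s * ennreal (sep * exp (- (E + 1))) \<le> ennreal s * R k S + ennreal s * R k (sym_diff S {k})"
      by (simp add: distrib_left)
  qed
  also have "of_nat K * (ennreal s * ennreal (sep * exp (- (E + 1)))) = ennreal (real K * (s * (sep * exp (- (E + 1)))))"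
    using sep0 by (simp add: ennreal_mult s_def ennreal_of_nat_eq_real_of_nat)
  also have "real K * (s * (sep * exp (- (E + 1)))) =
      2 * (w * (s * \<delta> powr (2 * \<beta>)) * A\<^sup>2 * g\<^sup>2 * c1 / 8 * exp (- (E + 1)))"
    unfolding sep_def power_mult_distrib B2 K\<delta>[symmetric] by simp
  also have "ennreal \<dots> = 2 * ennreal (w * (s * \<delta> powr (2 * \<beta>)) * A\<^sup>2 * g\<^sup>2 * c1 / 8 * exp (- (E + 1)))"
    using w bnd(2) by (subst ennreal_mult) (auto simp: s_def)
  finally have low: "ennreal (w * (s * \<delta> powr (2 * \<beta>)) * A\<^sup>2 * g\<^sup>2 * c1 / 8 * exp (- (E + 1))) \<le> U"
    by (subst (asm) ennreal_mult_le_mult_iff) auto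
  have "w * (w / (w + 1)) powr (2 * \<beta>) * A\<^sup>2 * g\<^sup>2 * c1 / 8 * exp (- (E + 1)) * real N powr - \<gamma> =
      (w * A\<^sup>2 * g\<^sup>2 * c1 / 8 * exp (- (E + 1))) * ((w / (w + 1)) powr (2 * \<beta>) * real N powr - \<gamma>)"
    by simp
  also have "\<dots> \<le> (w * A\<^sup>2 * g\<^sup>2 * c1 / 8 * exp (- (E + 1))) * (s * \<delta> powr (2 * \<beta>))"
    unfolding s_def using \<delta>\<gamma> w bnd(2) by (intro mult_left_mono) auto
  also have "\<dots> = w * (s * \<delta> powr (2 * \<beta>)) * A\<^sup>2 * g\<^sup>2 * c1 / 8 * exp (- (E + 1))" by simp
  finally have "ennreal (w * (w / (w + 1)) powr (2 * \<beta>) * A\<^sup>2 * g\<^sup>2 * c1 / 8 * exp (- (E + 1)) * real N powr - \<gamma>) \<le> U"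
    by (intro order_trans[OF ennreal_leI low])
  then show ?thesis by (simp add: U_def E_def)
qed

text \<open>
  A point near the middle of the unit interval where the density is positive, and continuity there.
  The window depends on the density alone, hence so will the constant in the lower bound.
\<close>

lemma density_window:
  fixes \<rho>' :: "real \<Rightarrow> real"
  assumes cont: "continuous_on {0..} \<rho>'" and nn: "\<forall>r\<ge>0. 0 \<le> \<rho>' r"
    and supp: "{0..1} \<subseteq> closure {r \<in> {0..}. \<rho>' r \<noteq> 0}"
  obtains a w c C where "0 \<le> a" "0 < w" "a + w \<le> 1" "0 < c"
    "\<And>r. r \<in> {a..a + w} \<Longrightarrow> c \<le> \<rho>' r \<and> \<rho>' r \<le> C"
proof -
  have "1 / 2 \<in> closure {r \<in> {0..}. \<rho>' r \<noteq> 0}" using supp by auto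
  then obtain r0 where r0: "0 \<le> r0" "\<rho>' r0 \<noteq> 0" "dist r0 (1 / 2) < 1 / 4"
    unfolding closure_approachable by (metis (mono_tags, lifting) atLeast_iff divide_pos_pos mem_Collect_eq zero_less_numeral zero_less_one)
  then have pos: "0 < \<rho>' r0" using nn by (metis less_eq_real_def)
  have r0': "1 / 4 < r0" "r0 < 3 / 4" using r0(3) unfolding dist_real_def by linarith+
  obtain d where d: "0 < d" "\<And>r. 0 \<le> r \<Longrightarrow> dist r r0 < d \<Longrightarrow> dist (\<rho>' r) (\<rho>' r0) < \<rho>' r0 / 2"
    using cont[unfolded continuous_on_iff, rule_format, of r0 "\<rho>' r0 / 2"] r0(1) pos by auto
  define w where "w = min (d / 2) (1 / 4)"
  have w: "0 < w" "w < d" "w \<le> 1 / 4" using d(1) by (auto simp: w_def)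
  show ?thesis
  proof (rule that[of r0 w "\<rho>' r0 / 2" "2 * \<rho>' r0"])
    fix r assume "r \<in> {r0..r0 + w}"
    then have "dist (\<rho>' r) (\<rho>' r0) < \<rho>' r0 / 2"
      using w r0(1) by (intro d(2)) (auto simp: dist_real_def)
    then show "\<rho>' r0 / 2 \<le> \<rho>' r \<and> \<rho>' r \<le> 2 * \<rho>' r0"
      unfolding dist_real_def using pos by linarith
  qed (use r0 r0' w pos in auto)
qed

theorem theorem4p1:
  fixes \<beta> L c_eta :: real and \<rho>' :: "real \<Rightarrow> real"
  assumes "0 < \<beta>" and "0 < L" and "0 < c_eta"
    and "continuous_on {0..} \<rho>'" and "\<forall>r\<ge>0. 0 \<le> \<rho>' r"
    and "{0..1} \<subseteq> closure {r \<in> {0..}. \<rho>' r \<noteq> 0}"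
  shows "\<exists>c\<^sub>0>0. \<forall>N\<ge>3. \<forall>(P :: 'a measure) (X :: 'a \<Rightarrow> nat \<Rightarrow> real ^ 'd) \<eta> p.
     interaction_model P N X \<eta> p \<rho>' \<and>
     exchangeable_finite_mean P N X \<and>
     pairs_cond_indep P N X \<and>
     pairs_cont_density P N X \<and>
     shift_KL_bound N p c_eta \<longrightarrow>
     ennreal (c\<^sub>0 * real N powr (- (2 * \<beta> / (2 * \<beta> + 1)))) \<le>
       liminf (\<lambda>M. INF h\<in>estimators N M. SUP \<phi>\<in>holder_zero \<beta> L. scaled_risk P N X \<eta> \<beta> M h \<phi>)"
proof -
  define l where "l = nat \<lfloor>\<beta>\<rfloor>"
  obtain A where A: "0 < A" "\<And>a \<delta> K S. 0 \<le> a \<Longrightarrow> 0 < \<delta> \<Longrightarrow> a + real K * \<delta> \<le> 1 \<Longrightarrow> S \<subseteq> {..<K} \<Longrightarrow>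
      bump_train l 0 (A * \<delta> powr \<beta>) a \<delta> S \<in> holder_zero \<beta> L"
    using bump_train_holder_zero[OF assms(1,2)] unfolding l_def by blast
  obtain a w c1 C1 where w: "0 \<le> a" "0 < w" "a + w \<le> 1"
    and c1: "0 < c1" "\<And>r. r \<in> {a..a + w} \<Longrightarrow> c1 \<le> \<rho>' r \<and> \<rho>' r \<le> C1"
    using density_window[OF assms(4-6)] by blast
  define c0 where "c0 = w * (w / (w + 1)) powr (2 * \<beta>) * A\<^sup>2 * ((3 / 16) ^ Suc l)\<^sup>2 * c1 / 8
      * exp (- (c_eta * A\<^sup>2 * C1 + 1))"
  have "0 < c0" unfolding c0_def using w c1(1) A(1) by simp
  moreover have "ennreal (c0 * real N powr (- (2 * \<beta> / (2 * \<beta> + 1)))) \<le>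
       liminf (\<lambda>M. INF h\<in>estimators N M. SUP \<phi>\<in>holder_zero \<beta> L. scaled_risk P N X \<eta> \<beta> M h \<phi>)"
    if "3 \<le> N" "interaction_model P N X \<eta> p \<rho>'" "shift_KL_bound N p c_eta"
    for N and P :: "'a measure" and X \<eta> :: "'a \<Rightarrow> nat \<Rightarrow> real ^ 'd" and p
  proof (rule Liminf_bounded, rule eventually_sequentiallyI[of 1], rule INF_greatest)
    fix M :: nat and h :: "(nat \<Rightarrow> (nat \<Rightarrow> real ^ 'd) \<times> (nat \<Rightarrow> real ^ 'd)) \<Rightarrow> real \<Rightarrow> real"
    assume "1 \<le> M" "h \<in> estimators N M"
    then show "ennreal (c0 * real N powr (- (2 * \<beta> / (2 * \<beta> + 1)))) \<le>
        (SUP \<phi>\<in>holder_zero \<beta> L. scaled_risk P N X \<eta> \<beta> M h \<phi>)"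
      unfolding c0_def
      using minimax_lower_bound[OF that(2,3) _ that(1) _ assms(1,4) w c1(2) c1(1) A(1) A(2)[OF w(1)]]
        assms(3) by simp
  qed
  ultimately show ?thesis by blast
qed

end
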